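(* Let $n\ge 1$ and let $K=K^{n-1}$ be an $(n-1)$-dimensional simplicial manifold with $h$-vector $(h_0,h_1,\ldots,h_n)$. Then $$h_{n-i}-h_i=(-1)^i\bigl(\chi(K^{n-1})-\chi(S^{n-1})\bigr)\binom{n}{i},\qquad i=0,1,\ldots,n,$$ where $\chi(K^{n-1})$ is the Euler number of $K^{n-1}$ and $\chi(S^{n-1})=1+(-1)^{n-1}$ is the Euler number of an $(n-1)$-sphere.
   Context: A simplicial manifold of dimension $n-1$ is a finite simplicial complex $K^{n-1}$ whose geometric realization $|K|$ is a topological manifold (without boundary) of dimension $n-1$. For an $(n-1)$-dimensional simplicial complex let $f_i$ be the number of its $i$-dimensional simplices, $f_{-1}=1$. The Euler number is $\chi(K)=f_0-f_1+\cdots+(-1)^{n-1}f_{n-1}$. The $h$-vector $(h_0,\ldots,h_n)$ is defined by the polynomial identity $$h_0t^n+\cdots+h_{n-1}t+h_n=(t-1)^n+f_0(t-1)^{n-1}+\cdots+f_{n-1}.$$ *)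

theory Defs
  imports "HOL-Analysis.Analysis" "HOL-Computational_Algebra.Polynomial"
begin

section \<open>Finite abstract simplicial complexes\<close>

text \<open>
  A simplex is identified with its finite set of vertices; the empty simplex belongs to every
  complex, and the vertex set of \<open>K\<close> is \<open>\<Union>K\<close>.
  These are abstract complexes, as opposed to the geometric ones that
  \<^const>\<open>simplicial_complex\<close> describes inside a Euclidean space; the geometric realization is
  a separate construction below.
\<close>

definition finite_simplicial_complex :: "'v set set \<Rightarrow> bool" where
  "finite_simplicial_complex K \<longleftrightarrow>
     finite K \<and> {} \<in> K \<and> (\<forall>\<sigma>\<in>K. finite \<sigma>) \<and> (\<forall>\<sigma>\<in>K. \<forall>\<tau>. \<tau> \<subseteq> \<sigma> \<longrightarrow> \<tau> \<in> K)"

text \<open>The dimension is an integer because the complex \<open>{{}}\<close> has dimension \<open>-1\<close>.\<close>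

definition simplex_dim :: "'v set \<Rightarrow> int" where
  "simplex_dim \<sigma> = int (card \<sigma>) - 1"

definition complex_dim :: "'v set set \<Rightarrow> int" where
  "complex_dim K = Max (simplex_dim ` K)"

definition f_vector :: "'v set set \<Rightarrow> int \<Rightarrow> nat" where
  "f_vector K j = card {\<sigma>\<in>K. simplex_dim \<sigma> = j}"

definition euler_number :: "'v set set \<Rightarrow> int" where
  "euler_number K = (\<Sum>j = 0..<nat (complex_dim K + 1). (-1) ^ j * int (f_vector K (int j)))"

text \<open>
  With \<open>n = dim K + 1\<close>, the polynomial
  \<open>f\<^sub>-\<^sub>1 (t-1)^n + f\<^sub>0 (t-1)^(n-1) + \<dots> + f\<^sub>n\<^sub>-\<^sub>1\<close> in \<open>t\<close>. It equals
  \<open>h\<^sub>0 t^n + \<dots> + h\<^sub>n\<close>, so that \<open>h\<^sub>i\<close> is its coefficient of \<open>t^(n-i)\<close>.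
\<close>

definition h_polynomial :: "'v set set \<Rightarrow> int poly" where
  "h_polynomial K = (let n = nat (complex_dim K + 1) in
     \<Sum>j = 0..n. smult (int (f_vector K (int j - 1))) ([:-1, 1:] ^ (n - j)))"

definition h_vector :: "'v set set \<Rightarrow> nat \<Rightarrow> int" where
  "h_vector K i = (let n = nat (complex_dim K + 1) in
     if i \<le> n then coeff (h_polynomial K) (n - i) else 0)"

lemma f_vector_minus_one:
  assumes "finite_simplicial_complex K"
  shows "f_vector K (-1) = 1"
proof -
  have "{\<sigma>\<in>K. simplex_dim \<sigma> = -1} = {{}}"
    using assms by (auto simp: finite_simplicial_complex_def simplex_dim_def)
  then show ?thesis by (simp add: f_vector_def)
qed

lemma h_vector_identity:
  assumes "n = nat (complex_dim K + 1)"
  shows "(\<Sum>i = 0..n. monom (h_vector K i) (n - i)) =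
         (\<Sum>j = 0..n. smult (int (f_vector K (int j - 1))) ([:-1, 1:] ^ (n - j)))"
proof -
  let ?p = "h_polynomial K"
  have "degree ?p \<le> n"
    unfolding h_polynomial_def Let_def assms[symmetric]
    by (intro degree_sum_le order_trans[OF degree_smult_le]) (simp_all add: degree_linear_power)
  then have "?p = (\<Sum>k\<le>n. monom (coeff ?p k) k)"
    by (rule poly_as_sum_of_monoms'[symmetric])
  also have "\<dots> = (\<Sum>i = 0..n. monom (h_vector K i) (n - i))"
    by (rule sum.reindex_bij_witness[of _ "\<lambda>i. n - i" "\<lambda>i. n - i"])
       (auto simp: h_vector_def Let_def assms[symmetric])
  finally show ?thesis
    by (simp add: h_polynomial_def Let_def assms)
qed


section \<open>Geometric realization\<close>

text \<open>
  Points are barycentric coordinate functions. Since only finitely many coordinates (those of the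
  vertices) are ever nonzero, the product topology induces the usual topology of a finite polyhedron.
\<close>

definition geometric_realization :: "'v set set \<Rightarrow> ('v \<Rightarrow> real) topology" where
  "geometric_realization K =
     subtopology (powertop_real UNIV)
       {x. (\<forall>v. 0 \<le> x v) \<and> {v. x v \<noteq> 0} \<in> K \<and> (\<Sum>v | x v \<noteq> 0. x v) = 1}"


section \<open>Topological and simplicial manifolds\<close>

definition second_countable_space :: "'a topology \<Rightarrow> bool" where
  "second_countable_space X \<longleftrightarrow>
     (\<exists>\<B>. countable \<B> \<and> (\<forall>B\<in>\<B>. openin X B) \<and>
          (\<forall>U x. openin X U \<and> x \<in> U \<longrightarrow> (\<exists>B\<in>\<B>. x \<in> B \<and> B \<subseteq> U)))"

text \<open>Charts map onto open subsets of the whole Euclidean space, so there is no boundary.\<close>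

definition topological_manifold :: "nat \<Rightarrow> 'a topology \<Rightarrow> bool" where
  "topological_manifold d X \<longleftrightarrow>
     Hausdorff_space X \<and> second_countable_space X \<and>
     (\<forall>x\<in>topspace X. \<exists>U W. openin X U \<and> x \<in> U \<and> openin (Euclidean_space d) W \<and>
        subtopology X U homeomorphic_space subtopology (Euclidean_space d) W)"

definition simplicial_manifold :: "nat \<Rightarrow> 'v set set \<Rightarrow> bool" where
  "simplicial_manifold d K \<longleftrightarrow>
     finite_simplicial_complex K \<and> complex_dim K = int d \<and>
     topological_manifold d (geometric_realization K)"

end

theory Submission
  imports Defs "HOL-Homology.Homology"
begin

text \<open>
  Write \<open>s = t - 1\<close>. The \<open>h\<close>-polynomial of a complex \<open>K\<close> of dimension \<open>n - 1\<close> is the sum of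
  \<open>s\<^bsup>n - card \<sigma>\<^esup>\<close> over all simplices \<open>\<sigma>\<close>, including the empty one, and the polynomial with reversed
  coefficients is the sum of \<open>(-s)\<^bsup>n - card \<sigma>\<^esup> (1+s)\<^bsup>card \<sigma>\<^esup>\<close>. An exchange of summation shows that the two
  differ by a multiple of \<open>(1-t)\<^sup>n\<close> as soon as every nonempty simplex \<open>\<sigma>\<close> satisfies
  \<open>\<Sum>\<tau> \<supseteq> \<sigma>. (-1)\<^bsup>card \<tau>\<^esup> = (-1)\<^sup>n\<close>. The multiple is the difference between the Euler numbers of
  \<open>K\<close> and of a sphere: it measures how far the empty simplex is from satisfying the same relation.
  Comparing coefficients gives the theorem (\<open>h_vector_reflection\<close>).

  The relation for the simplices containing \<open>\<sigma>\<close> (\<open>star_euler_relation\<close>) is topological. The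
  links of a triangulated topological manifold need not be spheres, so it is read off from local
  homology. Let \<open>x\<close> be the barycenter of \<open>\<sigma>\<close>. Pushing points away from \<open>x\<close> along rays retracts the
  punctured realization onto the complex of the simplices not containing \<open>\<sigma>\<close> (\<open>homology_punctured_realization\<close>). The long exact sequence of
  the realization and its punctured part makes Euler characteristics additive
  (\<open>has_euler_characteristic_pair\<close>), and at a point with a chart the relative term is
  \<open>(-1)\<^bsup>n-1\<^esup>\<close> by excision (\<open>has_euler_characteristic_local\<close>). The same three ingredients, applied to a
  maximal simplex in an arbitrary complex, whose interior is itself a chart, show that the
  homological Euler characteristic of a realization is the alternating number of its simplices
  (\<open>has_euler_characteristic_realization\<close>).

  Additivity rests on ranks of abelian groups, for which rank-nullity is proved directly from
  maximal independent families; it also passes finite rank along the exact sequence.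
\<close>

section \<open>Ranks of abelian groups\<close>

text \<open>
  The integer combinations are written multiplicatively, as group operations are here. Families are
  used instead of sets so that the images of independent elements under a homomorphism can be
  tested for independence before they are known to be distinct.
\<close>
definition independent_family :: "('g, 'm) monoid_scheme \<Rightarrow> ('i \<Rightarrow> 'g) \<Rightarrow> 'i set \<Rightarrow> bool" where
  "independent_family G x I \<longleftrightarrow>
     (\<forall>c :: 'i \<Rightarrow> int. finprod G (\<lambda>i. x i [^]\<^bsub>G\<^esub> c i) I = \<one>\<^bsub>G\<^esub> \<longrightarrow> (\<forall>i\<in>I. c i = 0))"

text \<open>
  Measuring rank for a subset \<open>S\<close> of \<open>G\<close> allows speaking of the rank of a kernel or an image inside
  the ambient group.
\<close>
definition rank_at_least :: "('g, 'm) monoid_scheme \<Rightarrow> 'g set \<Rightarrow> nat \<Rightarrow> bool" where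
  "rank_at_least G S k \<longleftrightarrow>
     (\<exists>A \<subseteq> S. finite A \<and> card A = k \<and> independent_family G (\<lambda>a. a) A)"

definition has_rank :: "('g, 'm) monoid_scheme \<Rightarrow> 'g set \<Rightarrow> nat \<Rightarrow> bool" where
  "has_rank G S r \<longleftrightarrow> (\<forall>k. rank_at_least G S k \<longleftrightarrow> k \<le> r)"

lemma independent_familyD:
  fixes c :: "'i \<Rightarrow> int"
  assumes "independent_family G x I" "finprod G (\<lambda>i. x i [^]\<^bsub>G\<^esub> c i) I = \<one>\<^bsub>G\<^esub>" "i \<in> I"
  shows "c i = 0"
  using assms unfolding independent_family_def by blast

lemma has_rank_unique: "has_rank G S r \<Longrightarrow> has_rank G S s \<Longrightarrow> r = s"
  unfolding has_rank_def by (metis le_antisym order_refl)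

context comm_group
begin

lemma finprod_int_pow:
  assumes "finite I" "x \<in> I \<rightarrow> carrier G"
  shows "finprod G x I [^] (k::int) = finprod G (\<lambda>i. x i [^] k) I"
  using assms
proof (induction I)
  case (insert j I)
  then have "x j \<in> carrier G" "x \<in> I \<rightarrow> carrier G" by auto
  with insert show ?case
    by (simp add: int_pow_distrib Pi_def)
qed simp

text \<open>
  Substituting linear combinations into a linear combination multiplies the coefficient matrix
  with the vector of outer coefficients.
\<close>
lemma finprod_lincomb:
  assumes "finite J" "finite I" "x \<in> I \<rightarrow> carrier G"
  shows "finprod G (\<lambda>j. finprod G (\<lambda>i. x i [^] (a j i :: int)) I [^] (c j :: int)) J
       = finprod G (\<lambda>i. x i [^] (\<Sum>j\<in>J. a j i * c j)) I"
  using assms(1)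
proof induction
  case empty
  have "finprod G (\<lambda>i. x i [^] (0::int)) I = \<one>"
    by (rule finprod_one_eqI) (use assms in \<open>auto simp: Pi_iff\<close>)
  then show ?case by simp
next
  case (insert k J)
  have *: "finprod G (\<lambda>i. x i [^] (a k i)) I [^] c k = finprod G (\<lambda>i. x i [^] (a k i * c k)) I"
    using assms by (subst finprod_int_pow) (auto intro!: finprod_cong' simp: int_pow_pow Pi_iff)
  have "finprod G (\<lambda>j. finprod G (\<lambda>i. x i [^] (a j i :: int)) I [^] (c j :: int)) (insert k J)
     = finprod G (\<lambda>i. x i [^] (a k i * c k)) I \<otimes> finprod G (\<lambda>i. x i [^] (\<Sum>j\<in>J. a j i * c j)) I"
    using insert assms by (subst finprod_insert) (auto simp: * Pi_iff)
  also have "\<dots> = finprod G (\<lambda>i. x i [^] (a k i * c k) \<otimes> x i [^] (\<Sum>j\<in>J. a j i * c j)) I"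
    using assms by (subst finprod_multf) (auto simp: Pi_iff)
  also have "\<dots> = finprod G (\<lambda>i. x i [^] (\<Sum>j\<in>insert k J. a j i * c j)) I"
    using assms insert by (intro finprod_cong') (auto simp: Pi_iff int_pow_mult)
  finally show ?case .
qed

lemma finprod_extend_coefficients:
  assumes "finite I" "J \<subseteq> I" "x \<in> I \<rightarrow> carrier G"
  shows "finprod G (\<lambda>i. x i [^] (if i \<in> J then c i else (0::int))) I = finprod G (\<lambda>i. x i [^] c i) J"
  using assms by (intro finprod_mono_neutral_cong_right) (auto simp: Pi_iff)

lemma independent_family_subset:
  assumes "independent_family G x I" "finite I" "J \<subseteq> I" "x \<in> I \<rightarrow> carrier G"
  shows "independent_family G x J"
  unfolding independent_family_def
proof (intro allI impI)
  fix c :: "_ \<Rightarrow> int"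
  assume "finprod G (\<lambda>i. x i [^] c i) J = \<one>"
  then have "finprod G (\<lambda>i. x i [^] (if i \<in> J then c i else (0::int))) I = \<one>"
    using finprod_extend_coefficients[OF assms(2-4)] by simp
  from independent_familyD[OF assms(1) this] have "(if i \<in> J then c i else 0) = 0" if "i \<in> I" for i
    using that by blast
  with assms(3) show "\<forall>i\<in>J. c i = 0" by (metis subsetD)
qed

lemma independent_family_inj_on:
  assumes "independent_family G x I" "finite I" "x \<in> I \<rightarrow> carrier G"
  shows "inj_on x I"
proof (rule inj_onI, rule ccontr)
  fix i j assume ij: "i \<in> I" "j \<in> I" "x i = x j" "i \<noteq> j"
  then have ind: "independent_family G x {i, j}"
    by (intro independent_family_subset[OF assms(1)]) (use assms in auto)
  have x: "x i \<in> carrier G" "x j \<in> carrier G" using assms ij by auto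
  have "finprod G (\<lambda>k. x k [^] (if k = i then 1 else -1 :: int)) {i, j}
      = x i [^] (1::int) \<otimes> x j [^] (-1::int)"
    using \<open>i \<noteq> j\<close> x by simp
  also have "\<dots> = \<one>"
    unfolding \<open>x i = x j\<close> using x by (simp add: int_pow_neg)
  finally have "finprod G (\<lambda>k. x k [^] (if k = i then 1 else -1 :: int)) {i, j} = \<one>" .
  from independent_familyD[OF ind this] have "(if i = i then 1 else -1 :: int) = 0" by blast
  then show False by simp
qed

lemma rank_at_least_familyI:
  assumes "independent_family G x I" "finite I" "x \<in> I \<rightarrow> S" "S \<subseteq> carrier G"
  shows "rank_at_least G S (card I)"
  unfolding rank_at_least_def
proof (intro exI conjI)
  have x: "x \<in> I \<rightarrow> carrier G" using assms(3,4) by (simp add: Pi_iff subset_iff)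
  have inj: "inj_on x I" by (rule independent_family_inj_on[OF assms(1,2) x])
  show "card (x ` I) = card I" using inj by (rule card_image)
  show "independent_family G (\<lambda>a. a) (x ` I)"
    unfolding independent_family_def
  proof (intro allI impI)
    fix c :: "_ \<Rightarrow> int"
    assume "finprod G (\<lambda>i. i [^] c i) (x ` I) = \<one>"
    then have "finprod G (\<lambda>i. x i [^] c (x i)) I = \<one>"
      using finprod_reindex[OF _ inj, of "\<lambda>i. i [^] c i"] x by (simp add: Pi_iff)
    from independent_familyD[OF assms(1) this] show "\<forall>i\<in>x ` I. c i = 0"
      by blast
  qed
  show "x ` I \<subseteq> S" using assms(3) by blast
  show "finite (x ` I)" using assms(2) by simp
qed

lemma rank_at_least_0: "rank_at_least G S 0"
  unfolding rank_at_least_def by (rule exI[of _ "{}"]) (auto simp: independent_family_def)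

lemma rank_at_least_mono:
  assumes "rank_at_least G S n" "m \<le> n" "S \<subseteq> carrier G"
  shows "rank_at_least G S m"
proof -
  obtain A where A: "A \<subseteq> S" "finite A" "card A = n" "independent_family G (\<lambda>a. a) A"
    using assms(1) unfolding rank_at_least_def by blast
  obtain B where B: "B \<subseteq> A" "card B = m"
    using obtain_subset_with_card_n assms(2) A(3) by metis
  then have "independent_family G (\<lambda>a. a) B"
    using A assms(3) by (intro independent_family_subset[OF A(4)]) auto
  with A B show ?thesis
    unfolding rank_at_least_def using finite_subset subset_trans by metis
qed

end

lemma hom_finprod_int_pow:
  assumes "comm_group G" "comm_group H" "f \<in> hom G H" "finite I" "x \<in> I \<rightarrow> carrier G"
  shows "f (finprod G (\<lambda>i. x i [^]\<^bsub>G\<^esub> (c i :: int)) I) = finprod H (\<lambda>i. f (x i) [^]\<^bsub>H\<^esub> c i) I"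
proof -
  interpret G: comm_group G by fact
  interpret H: comm_group H by fact
  interpret f: group_hom G H f using assms(3) by unfold_locales
  show ?thesis using assms(4,5)
  proof (induction I)
    case (insert j I)
    then have "x j \<in> carrier G" "x \<in> I \<rightarrow> carrier G" by auto
    with insert show ?case
      by (simp add: Pi_def f.hom_int_pow)
  qed simp
qed

text \<open>
  Preimages of independent elements of the image, put together with independent elements of the
  kernel, are independent: applying \<open>f\<close> to a relation kills the kernel part, so the coefficients of
  the preimages vanish, and what remains is a relation in the kernel.
\<close>
lemma rank_at_least_kernel_image:
  assumes "comm_group G" "comm_group H" "f \<in> hom G H"
    and "rank_at_least G (kernel G H f) a" "rank_at_least H (f ` carrier G) b"
  shows "rank_at_least G (carrier G) (a + b)"
proof -
  interpret G: comm_group G by fact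
  interpret H: comm_group H by fact
  interpret f: group_hom G H f using assms(3) by unfold_locales
  obtain A where A: "A \<subseteq> kernel G H f" "finite A" "card A = a" "independent_family G (\<lambda>x. x) A"
    using assms(4) unfolding rank_at_least_def by blast
  obtain B where B: "B \<subseteq> f ` carrier G" "finite B" "card B = b" "independent_family H (\<lambda>x. x) B"
    using assms(5) unfolding rank_at_least_def by blast
  obtain g where g: "\<And>y. y \<in> B \<Longrightarrow> g y \<in> carrier G \<and> f (g y) = y"
    using B(1) by (metis f_inv_into_f inv_into_into subsetD)
  have AC: "A \<subseteq> carrier G" "\<And>x. x \<in> A \<Longrightarrow> f x = \<one>\<^bsub>H\<^esub>" using A(1) by (auto simp: kernel_def)
  define x where "x = (\<lambda>s. case s of Inl a \<Rightarrow> a | Inr y \<Rightarrow> g y)"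
  have xC: "x \<in> A <+> B \<rightarrow> carrier G" using AC g by (auto simp: x_def)
  have "independent_family G x (A <+> B)"
    unfolding independent_family_def
  proof (intro allI impI)
    fix c :: "_ \<Rightarrow> int"
    assume c1: "finprod G (\<lambda>i. x i [^]\<^bsub>G\<^esub> c i) (A <+> B) = \<one>\<^bsub>G\<^esub>"
    have split: "finprod G (\<lambda>i. x i [^]\<^bsub>G\<^esub> c i) (A <+> B)
      = finprod G (\<lambda>i. i [^]\<^bsub>G\<^esub> c (Inl i)) A \<otimes>\<^bsub>G\<^esub> finprod G (\<lambda>i. g i [^]\<^bsub>G\<^esub> c (Inr i)) B"
      unfolding Plus_def using A(2) B(2) AC g
      by (subst G.finprod_Un_disjoint)
         (auto simp: x_def G.finprod_reindex inj_on_def Pi_iff subset_iff)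
    have fA: "f (finprod G (\<lambda>i. i [^]\<^bsub>G\<^esub> c (Inl i)) A) = \<one>\<^bsub>H\<^esub>"
      using AC A(2) by (subst hom_finprod_int_pow[OF assms(1-3)]) (auto intro!: H.finprod_one_eqI)
    have gB: "finprod G (\<lambda>i. g i [^]\<^bsub>G\<^esub> c (Inr i)) B \<in> carrier G"
      using g by (intro G.finprod_closed) auto
    have "\<one>\<^bsub>H\<^esub> = f (finprod G (\<lambda>i. g i [^]\<^bsub>G\<^esub> c (Inr i)) B)"
      using arg_cong[OF c1, of f] fA gB AC unfolding split
      by (subst (asm) f.hom_mult) (auto intro!: G.finprod_closed)
    also have "\<dots> = finprod H (\<lambda>i. f (g i) [^]\<^bsub>H\<^esub> c (Inr i)) B"
      using g B(2) by (intro hom_finprod_int_pow[OF assms(1-3)]) auto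
    also have "\<dots> = finprod H (\<lambda>i. i [^]\<^bsub>H\<^esub> c (Inr i)) B"
      using g B by (intro H.finprod_cong') auto
    finally have cB: "\<forall>i\<in>B. c (Inr i) = 0"
      using independent_familyD[OF B(4), of "\<lambda>i. c (Inr i)"] by simp
    then have "finprod G (\<lambda>i. g i [^]\<^bsub>G\<^esub> c (Inr i)) B = \<one>\<^bsub>G\<^esub>"
      using g by (intro G.finprod_one_eqI) auto
    moreover have "finprod G (\<lambda>i. i [^]\<^bsub>G\<^esub> c (Inl i)) A \<in> carrier G"
      using AC by (intro G.finprod_closed) auto
    ultimately have "finprod G (\<lambda>i. i [^]\<^bsub>G\<^esub> c (Inl i)) A = \<one>\<^bsub>G\<^esub>"
      using c1 unfolding split by simp
    then have "\<forall>i\<in>A. c (Inl i) = 0"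
      using independent_familyD[OF A(4), of "\<lambda>i. c (Inl i)"] by simp
    with cB show "\<forall>i\<in>A <+> B. c i = 0" by auto
  qed
  then have "rank_at_least G (carrier G) (card (A <+> B))"
    using A B xC by (intro G.rank_at_least_familyI) auto
  then show ?thesis using A B by (simp add: card_Plus)
qed

text \<open>
  Given independent elements \<open>B\<close> of \<open>G\<close>, choose \<open>I \<subseteq> B\<close> of greatest size whose image under \<open>f\<close> is
  independent. By maximality every \<open>j \<in> B - I\<close> occurs with a nonzero coefficient in a relation
  between the images of \<open>insert j I\<close>, and the corresponding combination \<open>y j\<close> lies in the kernel.
  The \<open>y j\<close> are independent because \<open>j\<close> occurs in no \<open>y m\<close> with \<open>m \<noteq> j\<close>. Working with one relation
  for each \<open>j\<close> replaces Gaussian elimination over the rationals.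
\<close>
lemma rank_at_least_imp_kernel_image:
  assumes "comm_group G" "comm_group H" "f \<in> hom G H"
    and "rank_at_least G (carrier G) n"
  shows "\<exists>a b. a + b = n \<and> rank_at_least G (kernel G H f) a \<and> rank_at_least H (f ` carrier G) b"
proof -
  interpret G: comm_group G by fact
  interpret H: comm_group H by fact
  interpret f: group_hom G H f using assms(3) by unfold_locales
  obtain B where B: "B \<subseteq> carrier G" "finite B" "card B = n" "independent_family G (\<lambda>x. x) B"
    using assms(4) unfolding rank_at_least_def by blast
  define P where "P = (\<lambda>I. I \<subseteq> B \<and> independent_family H f I)"
  have "P {}" by (simp add: P_def independent_family_def)
  moreover have "\<forall>I. P I \<longrightarrow> card I < Suc n"
    using B by (auto simp: P_def less_Suc_eq_le card_mono)
  ultimately obtain I where I: "P I" and max: "\<And>J. P J \<Longrightarrow> card J \<le> card I"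
    using ex_has_greatest_nat[of P "{}" card "Suc n"] by blast
  have IB: "I \<subseteq> B" "finite I" using I B finite_subset by (auto simp: P_def)
  have "\<exists>c. finprod H (\<lambda>i. f i [^]\<^bsub>H\<^esub> c i) (insert j I) = \<one>\<^bsub>H\<^esub> \<and> c j \<noteq> (0::int)"
    if j: "j \<in> B - I" for j
  proof -
    have "\<not> P (insert j I)"
      using max[of "insert j I"] j IB by auto
    then obtain c where c: "finprod H (\<lambda>i. f i [^]\<^bsub>H\<^esub> c i) (insert j I) = \<one>\<^bsub>H\<^esub>"
      and nz: "\<exists>i\<in>insert j I. c i \<noteq> (0::int)"
      using j IB unfolding P_def independent_family_def by auto
    have "c j \<noteq> 0"
    proof
      assume "c j = 0"
      moreover have "f j \<in> carrier H" "f \<in> I \<rightarrow> carrier H" using j IB B by auto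
      ultimately have "finprod H (\<lambda>i. f i [^]\<^bsub>H\<^esub> c i) I = \<one>\<^bsub>H\<^esub>"
        using c j IB by (simp add: Pi_iff)
      then have "\<forall>i\<in>I. c i = 0" using I independent_familyD unfolding P_def by metis
      with nz \<open>c j = 0\<close> show False by auto
    qed
    with c show ?thesis by blast
  qed
  then obtain c where c: "\<And>j. j \<in> B - I \<Longrightarrow> finprod H (\<lambda>i. f i [^]\<^bsub>H\<^esub> c j i) (insert j I) = \<one>\<^bsub>H\<^esub>"
    and nz: "\<And>j. j \<in> B - I \<Longrightarrow> c j j \<noteq> (0::int)"
    by metis
  define a where "a = (\<lambda>j i. if i \<in> insert j I then c j i else 0)"
  define y where "y = (\<lambda>j. finprod G (\<lambda>i. i [^]\<^bsub>G\<^esub> a j i) B)"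
  have "y j \<in> kernel G H f" if j: "j \<in> B - I" for j
  proof -
    have "f (y j) = finprod H (\<lambda>i. f i [^]\<^bsub>H\<^esub> a j i) B"
      unfolding y_def using B by (intro hom_finprod_int_pow[OF assms(1-3)]) auto
    also have "\<dots> = finprod H (\<lambda>i. f i [^]\<^bsub>H\<^esub> c j i) (insert j I)"
      unfolding a_def using B IB j by (intro H.finprod_extend_coefficients) auto
    finally show ?thesis
      using c[OF j] B unfolding kernel_def y_def by (auto intro!: G.finprod_closed)
  qed
  moreover have "independent_family G y (B - I)"
    unfolding independent_family_def
  proof (intro allI impI ballI)
    fix d :: "_ \<Rightarrow> int" and m
    assume "finprod G (\<lambda>j. y j [^]\<^bsub>G\<^esub> d j) (B - I) = \<one>\<^bsub>G\<^esub>" and m: "m \<in> B - I"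
    then have "finprod G (\<lambda>i. i [^]\<^bsub>G\<^esub> (\<Sum>j\<in>B - I. a j i * d j)) B = \<one>\<^bsub>G\<^esub>"
      unfolding y_def using B by (subst (asm) G.finprod_lincomb) auto
    then have "(\<Sum>j\<in>B - I. a j m * d j) = 0"
      using m by (intro independent_familyD[OF B(4), where c = "\<lambda>i. \<Sum>j\<in>B - I. a j i * d j"]) auto
    also have "(\<Sum>j\<in>B - I. a j m * d j) = (\<Sum>j\<in>{m}. a j m * d j)"
      using m B by (intro sum.mono_neutral_right) (auto simp: a_def)
    finally show "d m = 0" using nz[OF m] by (simp add: a_def)
  qed
  ultimately have "rank_at_least G (kernel G H f) (card (B - I))"
    using B by (intro G.rank_at_least_familyI) (auto simp: kernel_def)
  moreover have "rank_at_least H (f ` carrier G) (card I)"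
    using I IB B by (intro H.rank_at_least_familyI[of f]) (auto simp: P_def)
  moreover have "card (B - I) + card I = n"
    using IB B by (metis card_Diff_subset card_mono le_add_diff_inverse2)
  ultimately show ?thesis by blast
qed

text \<open>
  The two preceding lemmas say that the possible sizes of independent sets in \<open>G\<close> are the sums of
  those in the kernel and in the image, so the maximal sizes add.
\<close>
theorem rank_nullity:
  assumes "comm_group G" "comm_group H" "f \<in> hom G H"
    and "has_rank G (kernel G H f) a" "has_rank H (f ` carrier G) b"
  shows "has_rank G (carrier G) (a + b)"
  unfolding has_rank_def
proof (intro allI iffI)
  fix k assume "rank_at_least G (carrier G) k"
  from rank_at_least_imp_kernel_image[OF assms(1-3) this]
  show "k \<le> a + b" using assms(4,5) unfolding has_rank_def by auto
next
  fix k assume "k \<le> a + b"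
  then have k: "min k a \<le> a" "k - min k a \<le> b" "k = min k a + (k - min k a)" by auto
  have "rank_at_least G (carrier G) (min k a + (k - min k a))"
    using assms(4,5) k(1,2) unfolding has_rank_def
    by (intro rank_at_least_kernel_image[OF assms(1-3)]) blast+
  with k(3) show "rank_at_least G (carrier G) k" by simp
qed

lemma (in comm_group) has_rank_if_bounded:
  assumes "\<And>k. rank_at_least G S k \<Longrightarrow> k \<le> n" "S \<subseteq> carrier G"
  shows "\<exists>r. has_rank G S r"
proof -
  let ?r = "Greatest (rank_at_least G S)"
  have "rank_at_least G S ?r"
    by (rule GreatestI_nat[of "rank_at_least G S", OF rank_at_least_0]) (rule assms(1))
  moreover have "k \<le> ?r" if "rank_at_least G S k" for k
    by (rule Greatest_le_nat[of "rank_at_least G S", OF that]) (rule assms(1))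
  ultimately have "has_rank G S ?r"
    unfolding has_rank_def using rank_at_least_mono[OF _ _ assms(2)] by blast
  then show ?thesis ..
qed

lemma rank_nullity_ex:
  assumes "comm_group G" "comm_group H" "f \<in> hom G H" "has_rank G (carrier G) r"
  shows "\<exists>a b. has_rank G (kernel G H f) a \<and> has_rank H (f ` carrier G) b \<and> r = a + b"
proof -
  interpret G: comm_group G by fact
  interpret H: comm_group H by fact
  interpret f: group_hom G H f using assms(3) by unfold_locales
  have "\<exists>a. has_rank G (kernel G H f) a"
  proof (rule G.has_rank_if_bounded[of _ r])
    fix k assume "rank_at_least G (kernel G H f) k"
    from rank_at_least_kernel_image[OF assms(1-3) this H.rank_at_least_0]
    show "k \<le> r" using assms(4) by (simp add: has_rank_def)
  qed (auto simp: kernel_def)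
  moreover have "\<exists>b. has_rank H (f ` carrier G) b"
  proof (rule H.has_rank_if_bounded[of _ r])
    fix k assume "rank_at_least H (f ` carrier G) k"
    from rank_at_least_kernel_image[OF assms(1-3) G.rank_at_least_0 this]
    show "k \<le> r" using assms(4) by (simp add: has_rank_def)
  qed auto
  ultimately obtain a b where "has_rank G (kernel G H f) a" "has_rank H (f ` carrier G) b"
    by blast
  moreover from rank_nullity[OF assms(1-3) this] have "r = a + b"
    using assms(4) has_rank_unique by blast
  ultimately show ?thesis by blast
qed

lemma has_rank_trivial:
  assumes "comm_group G" "S = {\<one>\<^bsub>G\<^esub>}"
  shows "has_rank G S 0"
proof -
  interpret G: comm_group G by fact
  have "A = {}" if "A \<subseteq> {\<one>\<^bsub>G\<^esub>}" "independent_family G (\<lambda>a. a) A" for A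
  proof (rule ccontr)
    assume "A \<noteq> {}"
    then have "A = {\<one>\<^bsub>G\<^esub>}" using that by auto
    then show False using that(2) unfolding independent_family_def
      by (auto dest!: spec[of _ "\<lambda>_. 1"])
  qed
  then show ?thesis
    unfolding has_rank_def rank_at_least_def assms(2)
    by (auto intro!: exI[of _ "{}"] simp: independent_family_def)
qed

lemma has_rank_trivial_group: "comm_group G \<Longrightarrow> trivial_group G \<Longrightarrow> has_rank G (carrier G) 0"
  by (rule has_rank_trivial) (auto simp: trivial_group_def)

lemma has_rank_iso:
  assumes "comm_group G" "comm_group H" "G \<cong> H" "has_rank G (carrier G) r"
  shows "has_rank H (carrier H) r"
proof -
  interpret G: comm_group G by fact
  interpret H: comm_group H by fact
  obtain f where f: "f \<in> iso G H" using assms(3) by (auto simp: is_iso_def)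
  then interpret f: group_hom G H f by unfold_locales (auto simp: iso_def)
  have inj: "inj_on f (carrier G)" and surj: "f ` carrier G = carrier H"
    using f by (auto simp: iso_def bij_betw_def)
  have "kernel G H f = {\<one>\<^bsub>G\<^esub>}"
    using inj f.inj_iff_trivial_ker by (auto simp: )
  then show ?thesis
    using rank_nullity_ex[OF assms(1,2) f.homh assms(4)] has_rank_trivial[OF assms(1)]
      has_rank_unique surj by (metis add_0)
qed

text \<open>
  The relation \<open>n \<cdot> m - m \<cdot> n = 0\<close> rules out two independent integers.
\<close>
lemma has_rank_integer_group: "has_rank integer_group (carrier integer_group) 1"
proof -
  interpret Z: comm_group integer_group by (rule abelian_integer_group)
  have "rank_at_least integer_group (carrier integer_group) 1"
    unfolding rank_at_least_def independent_family_def
    by (rule exI[of _ "{1}"]) auto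
  moreover have "\<not> rank_at_least integer_group (carrier integer_group) 2"
  proof
    assume "rank_at_least integer_group (carrier integer_group) 2"
    then obtain A where A: "card A = 2" "independent_family integer_group (\<lambda>a. a) A"
      unfolding rank_at_least_def by blast
    then obtain m n where mn: "A = {m, n}" "m \<noteq> n" by (metis card_2_iff)
    define c where "c = (\<lambda>k. if k = m then n else -m)"
    have "finprod integer_group (\<lambda>k. k [^]\<^bsub>integer_group\<^esub> c k) A = \<one>\<^bsub>integer_group\<^esub>"
      unfolding mn using mn(2) by (simp add: c_def)
    then have "\<forall>k\<in>A. c k = 0" using independent_familyD[OF A(2)] by blast
    then show False using mn by (auto simp: c_def split: if_splits)
  qed
  ultimately have "rank_at_least integer_group (carrier integer_group) k \<longleftrightarrow> k \<le> 1" for k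
    using Z.rank_at_least_mono[of "carrier integer_group" k 2]
      Z.rank_at_least_mono[of "carrier integer_group" 1 k]
    by (cases "k \<le> 1") auto
  then show ?thesis
    unfolding has_rank_def by blast
qed

section \<open>Euler characteristics of pairs\<close>

text \<open>
  The alternating sum of Betti numbers of a pair. As a predicate it also expresses that these
  numbers are finite and vanish in high degrees. Negative degrees contribute nothing because the
  homology groups are trivial there.
\<close>
definition has_euler_characteristic :: "'a topology \<Rightarrow> 'a set \<Rightarrow> int \<Rightarrow> bool" where
  "has_euler_characteristic X S e \<longleftrightarrow>
     (\<exists>b N. (\<forall>p::nat. has_rank (relative_homology_group (int p) X S)
                        (carrier (relative_homology_group (int p) X S)) (b p)) \<and>
            (\<forall>p\<ge>N. b p = 0) \<and> e = (\<Sum>p<N. (-1) ^ p * int (b p)))"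

lemma alternating_sum_eventually_zero:
  assumes "\<And>p. p \<ge> N \<Longrightarrow> b p = (0::nat)" "N \<le> M"
  shows "(\<Sum>p<M. (-1) ^ p * int (b p)) = (\<Sum>p<N. (-1) ^ p * int (b p))"
  using assms by (intro sum.mono_neutral_right) auto

lemma has_euler_characteristic_unique:
  assumes "has_euler_characteristic X S e" "has_euler_characteristic X S e'"
  shows "e = e'"
proof -
  obtain b N where b: "\<And>p::nat. has_rank (relative_homology_group (int p) X S)
                        (carrier (relative_homology_group (int p) X S)) (b p)"
      "\<And>p. p \<ge> N \<Longrightarrow> b p = 0" "e = (\<Sum>p<N. (-1) ^ p * int (b p))"
    using assms(1) unfolding has_euler_characteristic_def by blast
  obtain b' N' where b': "\<And>p::nat. has_rank (relative_homology_group (int p) X S)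
                        (carrier (relative_homology_group (int p) X S)) (b' p)"
      "\<And>p. p \<ge> N' \<Longrightarrow> b' p = 0" "e' = (\<Sum>p<N'. (-1) ^ p * int (b' p))"
    using assms(2) unfolding has_euler_characteristic_def by blast
  have "b' = b" using b(1) b'(1) has_rank_unique by blast
  then show ?thesis
    using alternating_sum_eventually_zero[of N b "max N N'"]
      alternating_sum_eventually_zero[of N' b "max N N'"] b b' by simp
qed

lemma has_euler_characteristic_iso:
  assumes "has_euler_characteristic X S e"
    and "\<And>p. relative_homology_group p X S \<cong> relative_homology_group p Y T"
  shows "has_euler_characteristic Y T e"
proof -
  have *: "has_rank (relative_homology_group p X S) (carrier (relative_homology_group p X S)) r
     \<Longrightarrow> has_rank (relative_homology_group p Y T) (carrier (relative_homology_group p Y T)) r" for p r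
    by (rule has_rank_iso[OF _ _ assms(2)]) simp_all
  show ?thesis
    using assms(1) unfolding has_euler_characteristic_def by (blast intro: *)
qed

lemma has_euler_characteristic_concentrated:
  assumes "has_rank (relative_homology_group (int d) X S)
             (carrier (relative_homology_group (int d) X S)) r"
    and "\<And>p. p \<noteq> int d \<Longrightarrow> trivial_group (relative_homology_group p X S)"
  shows "has_euler_characteristic X S ((-1) ^ d * int r)"
  unfolding has_euler_characteristic_def
proof (intro exI conjI allI impI)
  fix p :: nat
  show "has_rank (relative_homology_group (int p) X S)
          (carrier (relative_homology_group (int p) X S)) (if p = d then r else 0)"
    using assms by (cases "p = d") (auto intro!: has_rank_trivial_group)
  show "(-1) ^ d * int r = (\<Sum>p<Suc d. (-1) ^ p * int (if p = d then r else 0))"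
    by (simp add: if_distrib sum.delta cong: if_cong)
qed auto

text \<open>
  In the long exact sequence of the pair, rank-nullity writes the rank of every group as the rank
  of the image coming in plus the rank of the image going out. In the alternating sum the ranks of
  the connecting homomorphisms cancel telescopically, from \<open>0\<close> in degree \<open>0\<close> up to a degree where
  all groups have rank \<open>0\<close>.
\<close>
theorem has_euler_characteristic_pair:
  assumes "has_euler_characteristic (subtopology X S) {} a" "has_euler_characteristic X S c"
  shows "has_euler_characteristic X {} (a + c)"
proof -
  let ?A = "\<lambda>p. homology_group p (subtopology X S)"
  let ?B = "\<lambda>p. homology_group p X"
  let ?C = "\<lambda>p. relative_homology_group p X S"
  let ?i = "\<lambda>p. hom_induced p (subtopology X S) {} X {} id"
  let ?j = "\<lambda>p. hom_induced p X {} X S id"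
  let ?d = "\<lambda>p. hom_boundary p X S"
  obtain ra N where ra: "\<And>p::nat. has_rank (?A (int p)) (carrier (?A (int p))) (ra p)"
      "\<And>p. p \<ge> N \<Longrightarrow> ra p = 0" "a = (\<Sum>p<N. (-1) ^ p * int (ra p))"
    using assms(1) unfolding has_euler_characteristic_def by blast
  obtain rc M where rc: "\<And>p::nat. has_rank (?C (int p)) (carrier (?C (int p))) (rc p)"
      "\<And>p. p \<ge> M \<Longrightarrow> rc p = 0" "c = (\<Sum>p<M. (-1) ^ p * int (rc p))"
    using assms(2) unfolding has_euler_characteristic_def by blast
  have ker_i: "kernel (?A p) (?B p) (?i p) = ?d (p + 1) ` carrier (?C (p + 1))" for p
    using homology_exactness_axiom_2[of "p + 1" X S] by simp
  have ker_j: "kernel (?B p) (?C p) (?j p) = ?i p ` carrier (?A p)" for p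
    using homology_exactness_axiom_3[of p X S] by simp
  have ker_d: "kernel (?C p) (?A (p - 1)) (?d p) = ?j p ` carrier (?B p)" for p
    using homology_exactness_axiom_1[of p X S] by simp
  have "\<exists>ki ii. has_rank (?A (int p)) (kernel (?A (int p)) (?B (int p)) (?i (int p))) ki \<and>
      has_rank (?B (int p)) (?i (int p) ` carrier (?A (int p))) ii \<and> ra p = ki + ii" for p
    by (intro rank_nullity_ex ra hom_induced_hom) simp_all
  then obtain ki ii where
    ki: "\<And>p::nat. has_rank (?A (int p)) (kernel (?A (int p)) (?B (int p)) (?i (int p))) (ki p)"
    and ii: "\<And>p::nat. has_rank (?B (int p)) (?i (int p) ` carrier (?A (int p))) (ii p)"
    and ra_eq: "\<And>p. ra p = ki p + ii p" by metis
  have "\<exists>kd rd. has_rank (?C (int p)) (kernel (?C (int p)) (?A (int p - 1)) (?d (int p))) kd \<and>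
      has_rank (?A (int p - 1)) (?d (int p) ` carrier (?C (int p))) rd \<and> rc p = kd + rd" for p
    by (intro rank_nullity_ex rc hom_boundary_hom) simp_all
  then obtain kd rd where
    kd: "\<And>p::nat. has_rank (?C (int p)) (kernel (?C (int p)) (?A (int p - 1)) (?d (int p))) (kd p)"
    and rd: "\<And>p::nat. has_rank (?A (int p - 1)) (?d (int p) ` carrier (?C (int p))) (rd p)"
    and rc_eq: "\<And>p. rc p = kd p + rd p" by metis
  \<comment> \<open>\<open>ki p\<close> and \<open>rd (Suc p)\<close> are both the rank of the image of the connecting homomorphism.\<close>
  have ki_eq: "ki p = rd (Suc p)" for p
    using ki[of p] rd[of "Suc p"] unfolding ker_i
    by (simp add: add.commute has_rank_unique)
  have rd_0: "rd 0 = 0"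
  proof -
    have "?d 0 ` carrier (?C 0) \<subseteq> carrier (?A (-1))"
      using hom_boundary_carrier[of 0 X S] by auto
    moreover have "carrier (?A (-1)) = {\<one>\<^bsub>?A (-1)\<^esub>}"
      using trivial_relative_homology_group[of "-1" "subtopology X S" "{}"]
      by (simp add: trivial_group_def)
    moreover have "carrier (?C 0) \<noteq> {}"
      using group.is_monoid[OF group_relative_homology_group] monoid.one_closed by (metis empty_iff)
    ultimately have "?d 0 ` carrier (?C 0) = {\<one>\<^bsub>?A (-1)\<^esub>}" by blast
    then have "has_rank (?A (-1)) (?d 0 ` carrier (?C 0)) 0"
      by (intro has_rank_trivial) simp_all
    then show ?thesis using rd[of 0] has_rank_unique by simp
  qed
  have rb: "has_rank (?B (int p)) (carrier (?B (int p))) (ii p + kd p)" for p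
  proof (rule rank_nullity[where f = "?j (int p)" and H = "?C (int p)"])
    show "has_rank (?B (int p)) (kernel (?B (int p)) (?C (int p)) (?j (int p))) (ii p)"
      unfolding ker_j by (rule ii)
    show "has_rank (?C (int p)) (?j (int p) ` carrier (?B (int p))) (kd p)"
      unfolding ker_d[symmetric] by (rule kd)
  qed (simp_all add: hom_induced_hom)
  define L where "L = max N M"
  have telescope: "(\<Sum>p<n. (-1) ^ p * int (rd p) + (-1) ^ p * int (rd (Suc p)))
       = - ((-1) ^ n * int (rd n))" for n
    by (induction n) (simp_all add: rd_0)
  have "rd L = 0" using rc_eq[of L] rc(2)[of L] by (simp add: L_def)
  have "a + c = (\<Sum>p<L. (-1) ^ p * int (ra p)) + (\<Sum>p<L. (-1) ^ p * int (rc p))"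
    using alternating_sum_eventually_zero[of N ra L] alternating_sum_eventually_zero[of M rc L] ra rc
    by (simp add: L_def)
  also have "\<dots> = (\<Sum>p<L. (-1) ^ p * int (ii p + kd p))
       + (\<Sum>p<L. (-1) ^ p * int (rd p) + (-1) ^ p * int (rd (Suc p)))"
    by (simp add: ra_eq rc_eq ki_eq sum.distrib[symmetric] algebra_simps)
  also have "\<dots> = (\<Sum>p<L. (-1) ^ p * int (ii p + kd p))"
    unfolding telescope using \<open>rd L = 0\<close> by simp
  finally have "a + c = (\<Sum>p<L. (-1) ^ p * int (ii p + kd p))" .
  moreover have "ii p + kd p = 0" if "p \<ge> L" for p
    using ra_eq[of p] rc_eq[of p] ra(2)[of p] rc(2)[of p] that by (simp add: L_def)
  ultimately show ?thesis
    unfolding has_euler_characteristic_def using rb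
    by (intro exI[of _ "\<lambda>p. ii p + kd p"] exI[of _ L]) blast
qed

lemma has_euler_characteristic_empty:
  assumes "topspace X = {}"
  shows "has_euler_characteristic X {} 0"
proof -
  have "has_euler_characteristic X {} ((-1) ^ 0 * int 0)"
    using trivial_homology_group_empty[OF assms]
    by (intro has_euler_characteristic_concentrated has_rank_trivial_group) simp_all
  then show ?thesis by simp
qed

section \<open>Local homology of locally Euclidean spaces\<close>

text \<open>
  Excising the closed set outside \<open>U\<close>, which is contained in the open complement of \<open>x\<close>.
\<close>
lemma relative_homology_group_open_excision:
  assumes "openin X U" "x \<in> U" "t1_space X"
  shows "relative_homology_group p (subtopology X U) (U - {x})
       \<cong> relative_homology_group p X (topspace X - {x})"
proof -
  let ?F = "topspace X - U"
  have x: "x \<in> topspace X" and U: "U \<subseteq> topspace X" using assms openin_subset by blast+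
  have cl: "X closure_of ?F = ?F"
    using assms(1) by (intro closure_of_closedin closedin_diff) auto
  have "openin X (topspace X - {x})"
    using iffD1[OF t1_space_openin_delete_alt assms(3)] by simp
  then have "X interior_of (topspace X - {x}) = topspace X - {x}"
    by (simp add: interior_of_openin)
  then have "hom_induced p (subtopology X (topspace X - ?F)) (topspace X - {x} - ?F)
        (subtopology X (topspace X)) (topspace X - {x}) id
    \<in> iso (relative_homology_group p (subtopology X (topspace X - ?F)) (topspace X - {x} - ?F))
          (relative_homology_group p (subtopology X (topspace X)) (topspace X - {x}))"
    using assms(2) by (intro homology_excision_axiom) (auto simp: cl)
  moreover have "topspace X - ?F = U" "topspace X - {x} - ?F = U - {x}" using U by auto
  ultimately show ?thesis by (auto simp: is_iso_def)
qed

text \<open>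
  Raising the dimension shifts the homology of the pair consisting of the space and the complement
  of the origin by one degree for each new coordinate, starting from the homology of a point in
  dimension \<open>0\<close>. The origin can be exchanged for \<open>y\<close> because homeomorphic closed subsets of a
  Euclidean space have complements with the same relative homology.
\<close>
lemma has_euler_characteristic_Euclidean_space:
  assumes "y \<in> topspace (Euclidean_space d)"
  shows "has_euler_characteristic (Euclidean_space d) (topspace (Euclidean_space d) - {y}) ((-1) ^ d)"
proof -
  let ?o = "\<lambda>_::nat. 0::real"
  let ?E = "Euclidean_space"
  have top0: "topspace (?E 0) = {?o}" by (auto simp: topspace_Euclidean_space)
  have closed1: "closedin (?E m) {z}" if "z \<in> topspace (?E m)" for m z
    using that Hausdorff_Euclidean_space closedin_Hausdorff_singleton by metis
  have o: "?o \<in> topspace (?E m)" for m by (simp add: topspace_Euclidean_space)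
  have "homology_group p (?E 0)
      \<cong> relative_homology_group (p + int d) (?E d) (topspace (?E d) - {?o})" for p
    using relative_homology_group_Euclidean_complement_step[of 0 "{?o}" p d] closed1[OF o] top0 by simp
  moreover have "relative_homology_group p (?E d) (topspace (?E d) - {?o})
      \<cong> relative_homology_group p (?E d) (topspace (?E d) - {y})" for p
  proof (rule isomorphic_relative_homology_groups_Euclidean_complements)
    show "subtopology (?E d) {?o} homeomorphic_space subtopology (?E d) {y}"
      unfolding homeomorphic_space_def homeomorphic_maps_def
      using assms o by (intro exI[of _ "\<lambda>_. y"] exI[of _ "\<lambda>_. ?o"]) auto
  qed (use closed1 o assms in auto)
  ultimately have iso: "homology_group p (?E 0)
      \<cong> relative_homology_group (p + int d) (?E d) (topspace (?E d) - {y})" for p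
    using iso_trans by blast
  have "has_euler_characteristic (?E d) (topspace (?E d) - {y}) ((-1) ^ d * int 1)"
  proof (rule has_euler_characteristic_concentrated)
    have "homology_group 0 (?E 0) \<cong> integer_group"
      by (rule homology_coefficients[OF top0])
    then have "integer_group \<cong> homology_group 0 (?E 0)"
      by (rule group.iso_sym[OF group_relative_homology_group])
    then have "integer_group \<cong> relative_homology_group (int d) (?E d) (topspace (?E d) - {y})"
      using iso_trans[OF _ iso[of 0]] by simp
    then show "has_rank (relative_homology_group (int d) (?E d) (topspace (?E d) - {y}))
       (carrier (relative_homology_group (int d) (?E d) (topspace (?E d) - {y}))) 1"
      by (intro has_rank_iso[OF abelian_integer_group _ _ has_rank_integer_group]) simp_all
  next
    fix p assume "p \<noteq> int d"
    then have "trivial_group (homology_group (p - int d) (?E 0))"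
      using homology_dimension_axiom[OF top0] by simp
    then show "trivial_group (relative_homology_group p (?E d) (topspace (?E d) - {y}))"
      using isomorphic_group_triviality[OF iso[of "p - int d"]] by simp
  qed
  then show ?thesis by simp
qed

text \<open>
  A chart, with excision applied on both sides of it, transports the computation in Euclidean space
  to \<open>X\<close>.
\<close>
theorem has_euler_characteristic_local:
  assumes "Hausdorff_space X" "openin X U" "x \<in> U" "openin (Euclidean_space d) W"
    and "subtopology X U homeomorphic_space subtopology (Euclidean_space d) W"
  shows "has_euler_characteristic X (topspace X - {x}) ((-1) ^ d)"
proof -
  let ?E = "Euclidean_space d"
  have U: "U \<subseteq> topspace X" and W: "W \<subseteq> topspace ?E" using assms openin_subset by blast+
  obtain f where f: "homeomorphic_map (subtopology X U) (subtopology ?E W) f"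
    using assms(5) homeomorphic_space by blast
  have top: "topspace (subtopology X U) = U" "topspace (subtopology ?E W) = W" using U W by auto
  have bij: "inj_on f U" "f ` U = W"
    using homeomorphic_imp_injective_map[OF f] homeomorphic_imp_surjective_map[OF f]
    unfolding top by auto
  have fx: "f x \<in> W" using bij assms(3) by blast
  have "f ` (U - {x}) = W - {f x}"
    using bij assms(3) by (auto simp: inj_on_def)
  then have "relative_homology_group p (subtopology X U) (U - {x})
      \<cong> relative_homology_group p (subtopology ?E W) (W - {f x})" for p
    using homeomorphic_map_relative_homology_iso[OF f, of "U - {x}" "W - {f x}" p] U
    unfolding top is_iso_def by blast
  then have 1: "relative_homology_group p (subtopology ?E W) (W - {f x})
      \<cong> relative_homology_group p (subtopology X U) (U - {x})" for p
    by (rule group.iso_sym[OF group_relative_homology_group])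
  have "relative_homology_group p (subtopology ?E W) (W - {f x})
      \<cong> relative_homology_group p ?E (topspace ?E - {f x})" for p
    using assms(4) fx Hausdorff_imp_t1_space[OF Hausdorff_Euclidean_space]
    by (rule relative_homology_group_open_excision)
  then have 2: "relative_homology_group p ?E (topspace ?E - {f x})
      \<cong> relative_homology_group p (subtopology ?E W) (W - {f x})" for p
    by (rule group.iso_sym[OF group_relative_homology_group])
  have 3: "relative_homology_group p (subtopology X U) (U - {x})
      \<cong> relative_homology_group p X (topspace X - {x})" for p
    using assms(2,3) Hausdorff_imp_t1_space[OF assms(1)]
    by (rule relative_homology_group_open_excision)
  show ?thesis
    using has_euler_characteristic_Euclidean_space[of "f x" d] fx W
    by (intro has_euler_characteristic_iso[OF _ iso_trans[OF 2 iso_trans[OF 1 3]]]) auto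
qed

section \<open>Puncturing a realization\<close>

definition realization_points :: "'v set set \<Rightarrow> ('v \<Rightarrow> real) set" where
  "realization_points K =
     {x. (\<forall>v. 0 \<le> x v) \<and> {v. x v \<noteq> 0} \<in> K \<and> (\<Sum>v | x v \<noteq> 0. x v) = 1}"

lemma geometric_realization_eq: "geometric_realization K = top_of_set (realization_points K)"
  unfolding geometric_realization_def realization_points_def euclidean_product_topology ..

lemma topspace_geometric_realization: "topspace (geometric_realization K) = realization_points K"
  by (simp add: geometric_realization_eq)

lemma finite_Union_complex: "finite_simplicial_complex K \<Longrightarrow> finite (\<Union>K)"
  by (auto simp: finite_simplicial_complex_def)

lemma realization_points_iff:
  assumes "finite V" "\<Union>K \<subseteq> V"
  shows "x \<in> realization_points K \<longleftrightarrow> (\<forall>v. 0 \<le> x v) \<and> {v. x v \<noteq> 0} \<in> K \<and> sum x V = 1"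
proof -
  have "(\<Sum>v | x v \<noteq> 0. x v) = sum x V" if "{v. x v \<noteq> 0} \<in> K"
    using that assms by (intro sum.mono_neutral_left) auto
  then show ?thesis by (auto simp: realization_points_def)
qed

lemma realization_points_nonneg: "x \<in> realization_points K \<Longrightarrow> 0 \<le> x v"
  by (simp add: realization_points_def)

lemma realization_points_mono: "L \<subseteq> K \<Longrightarrow> realization_points L \<subseteq> realization_points K"
  by (auto simp: realization_points_def)

text \<open>
  The largest \<open>c\<close> for which \<open>y - c x\<close> still has nonnegative coordinates. It describes how far the
  ray from \<open>x\<close> through \<open>y\<close> continues beyond \<open>y\<close> inside the simplex that carries \<open>y\<close>.
\<close>
definition ray_parameter :: "('v \<Rightarrow> real) \<Rightarrow> ('v \<Rightarrow> real) \<Rightarrow> real" where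
  "ray_parameter x y = Min ((\<lambda>v. y v / x v) ` {v. x v \<noteq> 0})"

text \<open>
  The point on the ray from \<open>x\<close> through \<open>y\<close> for which \<open>y\<close> is the convex combination with weight
  \<open>c\<close> at \<open>x\<close> and \<open>1 - c\<close> at that point.
\<close>
definition push_away :: "('v \<Rightarrow> real) \<Rightarrow> real \<Rightarrow> ('v \<Rightarrow> real) \<Rightarrow> 'v \<Rightarrow> real" where
  "push_away x c y = (\<lambda>v. (y v - c * x v) / (1 - c))"

lemma continuous_on_Min:
  fixes f :: "'i \<Rightarrow> 'a::topological_space \<Rightarrow> real"
  assumes "finite I" "I \<noteq> {}" "\<And>i. i \<in> I \<Longrightarrow> continuous_on S (f i)"
  shows "continuous_on S (\<lambda>y. Min ((\<lambda>i. f i y) ` I))"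
  using assms
proof (induction rule: finite_ne_induct)
  case (insert i I)
  then have "continuous_on S (\<lambda>y. min (f i y) (Min ((\<lambda>i. f i y) ` I)))"
    by (intro continuous_intros) auto
  with insert show ?case by simp
qed simp

locale point_of_realization =
  fixes L :: "'v set set" and x :: "'v \<Rightarrow> real"
  assumes complex: "finite_simplicial_complex L" and x: "x \<in> realization_points L"
begin

abbreviation carrier_simplex :: "'v set" where "carrier_simplex \<equiv> {v. x v \<noteq> 0}"

lemma finV: "finite (\<Union>L)"
  using complex by (rule finite_Union_complex)

lemma carrier_simplex: "carrier_simplex \<in> L" "finite carrier_simplex" "carrier_simplex \<noteq> {}"
proof -
  show L: "carrier_simplex \<in> L" using x by (simp add: realization_points_def)
  then show "finite carrier_simplex" using complex by (simp add: finite_simplicial_complex_def)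
  show "carrier_simplex \<noteq> {}"
  proof
    assume "carrier_simplex = {}"
    then show False using x unfolding realization_points_def mem_Collect_eq by simp
  qed
qed

lemma x_pos: "v \<in> carrier_simplex \<Longrightarrow> 0 < x v"
  using x by (auto simp: realization_points_def less_le)

lemma ray_parameter_le: "ray_parameter x y * x v \<le> y v" if "y \<in> realization_points L"
proof (cases "v \<in> carrier_simplex")
  case True
  then have "ray_parameter x y \<le> y v / x v"
    unfolding ray_parameter_def using carrier_simplex by (intro Min_le) auto
  then show ?thesis using x_pos[OF True] by (simp add: field_simps)
next
  case False
  then show ?thesis using that by (simp add: realization_points_def)
qed

lemma ray_parameter_attained: "\<exists>v\<in>carrier_simplex. y v = ray_parameter x y * x v"
proof -
  have "ray_parameter x y \<in> (\<lambda>v. y v / x v) ` carrier_simplex"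
    unfolding ray_parameter_def using carrier_simplex by (intro Min_in) auto
  then show ?thesis by auto
qed

lemma ray_parameter_nonneg: "0 \<le> ray_parameter x y" if "y \<in> realization_points L"
proof -
  obtain v where v: "v \<in> carrier_simplex" "y v = ray_parameter x y * x v"
    using ray_parameter_attained by blast
  have "0 \<le> ray_parameter x y * x v"
    using realization_points_nonneg[OF that, of v] v(2) by simp
  with x_pos[OF v(1)] show ?thesis by (simp add: zero_le_mult_iff)
qed

text \<open>
  Otherwise \<open>x v \<le> y v\<close> for every \<open>v\<close>, and since both families of barycentric coordinates have sum
  \<open>1\<close>, they agree.
\<close>
lemma ray_parameter_less_1:
  assumes "y \<in> realization_points L" "y \<noteq> x"
  shows "ray_parameter x y < 1"
proof (rule ccontr)
  assume "\<not> ray_parameter x y < 1"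
  then have ge: "x v \<le> y v" for v
    using ray_parameter_le[OF assms(1), of v] realization_points_nonneg[OF x, of v]
      mult_right_mono[of 1 "ray_parameter x y" "x v"] by simp
  have sums: "sum x (\<Union>L) = 1" "sum y (\<Union>L) = 1"
    using x assms(1) realization_points_iff[OF finV order_refl] by blast+
  then have "(\<Sum>v\<in>\<Union>L. y v - x v) = 0" by (simp add: sum_subtractf)
  then have eq: "\<forall>v\<in>\<Union>L. y v - x v = 0"
    using finV ge by (subst (asm) sum_nonneg_eq_0_iff) auto
  have "y v = x v" for v
  proof (cases "v \<in> \<Union>L")
    case False
    have "{v. x v \<noteq> 0} \<subseteq> \<Union>L" "{v. y v \<noteq> 0} \<subseteq> \<Union>L"
      using x assms(1) unfolding realization_points_def by blast+
    with False have "y v = 0" "x v = 0" by blast+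
    then show ?thesis by simp
  qed (use eq in auto)
  with assms(2) show False by auto
qed

text \<open>
  Moving away from \<open>x\<close> creates no new nonzero coordinate, so the carrying simplex can only shrink to
  a face.
\<close>
lemma push_away_in:
  assumes y: "y \<in> realization_points L" and c: "0 \<le> c" "c \<le> ray_parameter x y" "c < 1"
  shows "push_away x c y \<in> realization_points L"
proof -
  have le: "c * x v \<le> y v" for v
    using ray_parameter_le[OF y, of v] mult_right_mono[OF c(2) realization_points_nonneg[OF x, of v]]
    by linarith
  have nonneg: "0 \<le> push_away x c y v" for v
    using le[of v] c by (simp add: push_away_def)
  have "{v. push_away x c y v \<noteq> 0} \<subseteq> {v. y v \<noteq> 0}"
  proof safe
    fix v assume "push_away x c y v \<noteq> 0" "y v = 0"
    moreover have "c * x v = 0"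
      using le[of v] \<open>y v = 0\<close> mult_nonneg_nonneg[OF c(1) realization_points_nonneg[OF x, of v]]
      by linarith
    ultimately show False by (simp add: push_away_def)
  qed
  moreover have "{v. y v \<noteq> 0} \<in> L" using y by (simp add: realization_points_def)
  ultimately have supp: "{v. push_away x c y v \<noteq> 0} \<in> L"
    using complex unfolding finite_simplicial_complex_def by blast
  have sums: "sum x (\<Union>L) = 1" "sum y (\<Union>L) = 1"
    using x y realization_points_iff[OF finV order_refl] by blast+
  have "sum (push_away x c y) (\<Union>L) = (sum y (\<Union>L) - c * sum x (\<Union>L)) / (1 - c)"
    by (simp add: push_away_def sum_divide_distrib[symmetric] sum_subtractf sum_distrib_left)
  also have "\<dots> = 1" using sums c by simp
  finally show ?thesis
    using nonneg supp realization_points_iff[OF finV order_refl] by blast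
qed

lemma push_away_neq:
  assumes "y \<noteq> x" "c < 1"
  shows "push_away x c y \<noteq> x"
proof
  assume eq: "push_away x c y = x"
  have "y v = x v" for v
    using fun_cong[OF eq, of v] assms(2) by (simp add: push_away_def field_simps)
  with assms(1) show False by auto
qed

text \<open>What is left of the complex when the open star of the carrier simplex of \<open>x\<close> is removed.\<close>
abbreviation residual :: "'v set set" where "residual \<equiv> {\<tau>\<in>L. \<not> carrier_simplex \<subseteq> \<tau>}"

text \<open>
  At the end of the ray the coordinate at which the minimum is attained vanishes, so a vertex of
  the carrier simplex of \<open>x\<close> has been lost.
\<close>
lemma push_away_ray_parameter_in:
  assumes "y \<in> realization_points L" "y \<noteq> x"
  shows "push_away x (ray_parameter x y) y \<in> realization_points residual"
proof -
  have "push_away x (ray_parameter x y) y \<in> realization_points L"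
    using push_away_in[OF assms(1) ray_parameter_nonneg[OF assms(1)] order_refl
        ray_parameter_less_1[OF assms]] .
  moreover obtain v where "v \<in> carrier_simplex" "push_away x (ray_parameter x y) y v = 0"
    using ray_parameter_attained[of y] by (auto simp: push_away_def)
  ultimately show ?thesis by (auto simp: realization_points_def)
qed

lemma ray_parameter_residual:
  assumes "y \<in> realization_points residual"
  shows "ray_parameter x y = 0"
proof -
  have y: "y \<in> realization_points L" using assms realization_points_mono[of residual L] by auto
  obtain v where v: "v \<in> carrier_simplex" "y v = 0"
    using assms by (auto simp: realization_points_def)
  then have "ray_parameter x y \<le> 0"
    using ray_parameter_le[OF y, of v] x_pos[OF v(1)] by (simp add: mult_le_0_iff)
  with ray_parameter_nonneg[OF y] show ?thesis by simp
qed

lemma push_away_0: "push_away x 0 y = y"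
  by (simp add: push_away_def)

lemma continuous_on_ray_parameter: "continuous_on S (ray_parameter x)"
proof -
  have "continuous_on S (\<lambda>y. y v / x v)" if "v \<in> carrier_simplex" for v
    using that by (intro continuous_intros continuous_on_product_then_coordinatewise) auto
  then have "continuous_on S (\<lambda>y. Min ((\<lambda>v. y v / x v) ` carrier_simplex))"
    using carrier_simplex by (intro continuous_on_Min) auto
  then show ?thesis by (simp add: ray_parameter_def[abs_def])
qed

text \<open>
  Pushing points away from \<open>x\<close> along rays is a deformation retraction of the punctured realization.
  It fixes the realization of the residual complex, where the ray parameter is \<open>0\<close>.
\<close>
theorem homology_punctured_realization:
  "homology_group p (subtopology (geometric_realization L) (realization_points L - {x}))
   \<cong> homology_group p (geometric_realization residual)"
proof -
  let ?S = "realization_points L - {x}" and ?T = "realization_points residual"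
  let ?r = "\<lambda>y. push_away x (ray_parameter x y) y"
  let ?h = "\<lambda>z. push_away x ((1 - fst z) * ray_parameter x (snd z)) (snd z)"
  have TS: "?T \<subseteq> ?S"
    using realization_points_mono[of residual L] by (auto simp: realization_points_def)
  have h_in: "push_away x ((1 - t) * ray_parameter x y) y \<in> ?S" if "t \<in> {0..1}" "y \<in> ?S" for t y
  proof -
    have y: "y \<in> realization_points L" "y \<noteq> x" using that by auto
    have "0 \<le> (1 - t) * ray_parameter x y" "(1 - t) * ray_parameter x y \<le> ray_parameter x y"
      using that ray_parameter_nonneg[OF y(1)] by (auto simp: mult_left_le_one_le)
    moreover from this have "(1 - t) * ray_parameter x y < 1"
      using ray_parameter_less_1[OF y] by linarith
    ultimately show ?thesis using push_away_in[OF y(1)] push_away_neq[OF y(2)] by blast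
  qed
  have cont_h: "continuous_on ({0..1} \<times> ?S) ?h"
    unfolding push_away_def
  proof (intro continuous_intros continuous_on_coordinatewise_then_product ballI)
    show "continuous_on ({0..1} \<times> ?S) (\<lambda>z. ray_parameter x (snd z))"
      by (rule continuous_on_compose2[OF continuous_on_ray_parameter[of UNIV]])
         (auto intro: continuous_on_snd continuous_on_id)
    \<comment> \<open>The parameter occurs once in the numerator and once in the denominator.\<close>
    then show "continuous_on ({0..1} \<times> ?S) (\<lambda>z. ray_parameter x (snd z))" .
  next
    fix v
    show "continuous_on ({0..1} \<times> ?S) (\<lambda>z. snd z v)"
      by (rule continuous_on_product_then_coordinatewise) (intro continuous_on_snd continuous_on_id)
  next
    fix z :: "real \<times> ('v \<Rightarrow> real)" assume z: "z \<in> {0..1} \<times> ?S"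
    have y: "snd z \<in> realization_points L" "snd z \<noteq> x" using z by auto
    have "(1 - fst z) * ray_parameter x (snd z) \<le> ray_parameter x (snd z)"
      using z ray_parameter_nonneg[OF y(1)] by (auto simp: mult_left_le_one_le)
    then show "1 - (1 - fst z) * ray_parameter x (snd z) \<noteq> 0"
      using ray_parameter_less_1[OF y] by linarith
  qed
  \<comment> \<open>Time runs backwards, from the retraction at \<open>0\<close> to the identity at \<open>1\<close>.\<close>
  have hom: "homotopic_with (\<lambda>h. True) (top_of_set ?S) (top_of_set ?S) ?r id"
    unfolding homotopic_with_def
  proof (intro exI[of _ ?h] conjI allI ballI)
    show "continuous_map (prod_topology (top_of_set {0..1}) (top_of_set ?S)) (top_of_set ?S) ?h"
      using cont_h h_in by (auto simp: prod_topology_subtopology_eu continuous_map_in_subtopology)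
  qed (simp_all add: push_away_0)
  have "continuous_on ?S ?r"
    using homotopic_with_imp_continuous[OF hom] by simp
  then have "retraction_maps (top_of_set ?S) (top_of_set ?T) ?r id"
    using TS push_away_ray_parameter_in unfolding retraction_maps_def
    by (auto simp: continuous_map_in_subtopology ray_parameter_residual push_away_0)
  from deformation_retract_imp_isomorphic_homology_groups[OF this hom]
  have "homology_group p (top_of_set ?S) \<cong> homology_group p (top_of_set ?T)" .
  moreover have "subtopology (geometric_realization L) ?S = top_of_set ?S"
    by (simp add: geometric_realization_eq subtopology_subtopology Int_absorb1)
  ultimately show ?thesis by (simp add: geometric_realization_eq)
qed

corollary has_euler_characteristic_star:
  assumes "has_euler_characteristic (geometric_realization residual) {} a"
    and "has_euler_characteristic (geometric_realization L)
           (topspace (geometric_realization L) - {x}) c"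
  shows "has_euler_characteristic (geometric_realization L) {} (a + c)"
proof (rule has_euler_characteristic_pair)
  show "has_euler_characteristic
     (subtopology (geometric_realization L) (topspace (geometric_realization L) - {x})) {} a"
    unfolding topspace_geometric_realization
    by (rule has_euler_characteristic_iso[OF assms(1)])
       (rule group.iso_sym[OF group_relative_homology_group homology_punctured_realization])
qed fact

end

section \<open>Euler characteristics of complexes and manifolds\<close>

definition barycenter :: "'v set \<Rightarrow> 'v \<Rightarrow> real" where
  "barycenter \<sigma> = (\<lambda>v. if v \<in> \<sigma> then 1 / card \<sigma> else 0)"

lemma barycenter_support:
  assumes "finite \<sigma>"
  shows "{v. barycenter \<sigma> v \<noteq> 0} = \<sigma>"
  using assms by (auto simp: barycenter_def)

lemma barycenter_in_realization:
  assumes "finite_simplicial_complex K" "\<sigma> \<in> K" "\<sigma> \<noteq> {}"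
  shows "barycenter \<sigma> \<in> realization_points K"
proof -
  have fin: "finite \<sigma>" using assms by (simp add: finite_simplicial_complex_def)
  have "sum (barycenter \<sigma>) \<sigma> = 1" using fin assms(3) by (simp add: barycenter_def)
  then show ?thesis
    using assms(2) barycenter_support[OF fin]
    by (simp add: realization_points_def) (simp add: barycenter_def)
qed

lemma finite_simplicial_complex_remove_star:
  assumes "finite_simplicial_complex K" "\<sigma> \<noteq> {}"
  shows "finite_simplicial_complex {\<tau>\<in>K. \<not> \<sigma> \<subseteq> \<tau>}"
  using assms unfolding finite_simplicial_complex_def by auto

text \<open>
  A maximal simplex is not a proper face, so the points with all its coordinates positive form an
  open set of the realization. Dropping the barycentric coordinate of one vertex, here \<open>b k\<close>, maps
  it to the open set of positive coordinates with sum less than \<open>1\<close>.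
\<close>
lemma open_simplex_chart:
  assumes K: "finite_simplicial_complex K" and \<sigma>: "\<sigma> \<in> K" "card \<sigma> = Suc k"
    and maximal: "\<And>\<tau>. \<tau> \<in> K \<Longrightarrow> \<sigma> \<subseteq> \<tau> \<Longrightarrow> \<tau> = \<sigma>"
  obtains U W where "openin (geometric_realization K) U" "barycenter \<sigma> \<in> U"
    "openin (Euclidean_space k) W"
    "subtopology (geometric_realization K) U homeomorphic_space subtopology (Euclidean_space k) W"
proof -
  have fin: "finite \<sigma>" and ne: "\<sigma> \<noteq> {}" using \<sigma>(2) card.infinite by force+
  obtain b where b: "bij_betw b {..k} \<sigma>"
    using \<sigma>(2) fin by (metis card_atMost finite_atMost finite_same_card_bij)
  have b_in: "b i \<in> \<sigma>" if "i \<le> k" for i using b that by (auto simp: bij_betw_def)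
  have b_eq: "b i = b j \<longleftrightarrow> i = j" if "i \<le> k" "j \<le> k" for i j
    using b that by (auto simp: bij_betw_def inj_on_def)
  have inv_b: "inv_into {..k} b (b i) = i" if "i \<le> k" for i
    using b that by (auto simp: bij_betw_def)
  have b_cases: "\<exists>i\<le>k. v = b i" if "v \<in> \<sigma>" for v
    using b that by (auto simp: bij_betw_def)
  define E where "E = {w :: nat \<Rightarrow> real. \<forall>i\<ge>k. w i = 0}"
  have E: "Euclidean_space k = top_of_set E"
    by (simp add: Euclidean_space_def E_def euclidean_product_topology)
  define U where "U = realization_points K \<inter> (\<Inter>v\<in>\<sigma>. {y. 0 < y v})"
  define W where "W = E \<inter> ((\<Inter>i\<in>{..<k}. {w. 0 < w i}) \<inter> {w. (\<Sum>i<k. w i) < 1})"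
  define f where "f = (\<lambda>(y :: 'a \<Rightarrow> real) i. if i < k then y (b i) else 0)"
  define g where "g = (\<lambda>(w :: nat \<Rightarrow> real) v. if v \<in> \<sigma> then
      (if v = b k then 1 - (\<Sum>i<k. w i) else w (inv_into {..k} b v)) else 0)"
  have coord: "continuous_on S (\<lambda>y :: 'i \<Rightarrow> real. y v)" for S and v :: 'i
    by (rule continuous_on_product_then_coordinatewise) (rule continuous_on_id)
  have "open (\<Inter>v\<in>\<sigma>. {y :: 'a \<Rightarrow> real. 0 < y v})"
    using fin by (intro open_INT ballI open_Collect_less continuous_on_const coord)
  then have openU: "openin (geometric_realization K) U"
    unfolding U_def geometric_realization_eq by (rule openin_open_Int)
  have "open ((\<Inter>i\<in>{..<k}. {w :: nat \<Rightarrow> real. 0 < w i}) \<inter> {w. (\<Sum>i<k. w i) < 1})"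
    by (intro open_Int open_INT ballI open_Collect_less continuous_on_const continuous_on_sum coord) auto
  then have openW: "openin (Euclidean_space k) W"
    unfolding W_def E by (rule openin_open_Int)
  have supp_U: "{v. y v \<noteq> 0} = \<sigma>" if "y \<in> U" for y
    using that by (intro maximal) (force simp: U_def realization_points_def)+
  have sum_b: "sum y \<sigma> = (\<Sum>i<k. y (b i)) + y (b k)" for y :: "'a \<Rightarrow> real"
    using sum.reindex_bij_betw[OF b, of y] by (simp add: lessThan_Suc_atMost[symmetric])
  have sum_U: "(\<Sum>i<k. y (b i)) = 1 - y (b k)" if "y \<in> U" for y
    using supp_U[OF that] that sum_b[of y] by (simp add: U_def realization_points_def)
  have pos_U: "0 < y v" if "y \<in> U" "v \<in> \<sigma>" for y v using that by (auto simp: U_def)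
  have f_W: "f y \<in> W" if y: "y \<in> U" for y
    using sum_U[OF y] pos_U[OF y] b_in by (auto simp: W_def E_def f_def)
  have g_b: "g w (b i) = (if i = k then 1 - (\<Sum>i<k. w i) else w i)" if "i \<le> k" for w i
    using that b_in b_eq inv_b by (simp add: g_def)
  have g_pos: "0 < g w v" if w: "w \<in> W" and v: "v \<in> \<sigma>" for w v
  proof -
    obtain i where i: "i \<le> k" "v = b i" using b_cases[OF v] by blast
    show ?thesis
      using w i(1) unfolding i(2) g_b[OF i(1)] by (auto simp: W_def)
  qed
  have g_outside: "g w v = 0" if "v \<notin> \<sigma>" for w v using that by (simp add: g_def)
  have g_U: "g w \<in> U" if w: "w \<in> W" for w
  proof -
    have supp: "{v. g w v \<noteq> 0} = \<sigma>"
      using g_pos[OF w] g_outside by (auto simp: order_less_imp_not_eq2)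
    have "sum (g w) \<sigma> = 1"
      unfolding sum_b by (simp add: g_b)
    moreover have "0 \<le> g w v" for v
      using g_pos[OF w, of v] g_outside[of v w] by (cases "v \<in> \<sigma>") auto
    ultimately show ?thesis
      using supp \<sigma>(1) g_pos[OF w] by (simp add: U_def realization_points_def)
  qed
  have gf: "g (f y) = y" if y: "y \<in> U" for y
  proof
    fix v
    show "g (f y) v = y v"
    proof (cases "v \<in> \<sigma>")
      case True
      then obtain i where i: "i \<le> k" "v = b i" using b_cases by blast
      then show ?thesis
        using sum_U[OF y] unfolding i(2) g_b[OF i(1)] by (auto simp: f_def)
    next
      case False
      then have "y v = 0" using supp_U[OF y] by blast
      then show ?thesis using g_outside[OF False] by simp
    qed
  qed
  have fg: "f (g w) = w" if w: "w \<in> W" for w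
    using w by (auto simp: f_def g_b W_def E_def fun_eq_iff)
  have cont_f: "continuous_on U f"
  proof (rule continuous_on_coordinatewise_then_product)
    show "continuous_on U (\<lambda>y. f y i)" for i
      by (cases "i < k") (simp_all add: f_def coord)
  qed
  have cont_g: "continuous_on W g"
  proof (rule continuous_on_coordinatewise_then_product)
    fix v
    have "continuous_on W (\<lambda>w. 1 - (\<Sum>i<k. w i))"
      by (intro continuous_on_diff continuous_on_const continuous_on_sum coord)
    then show "continuous_on W (\<lambda>w. g w v)"
      by (cases "v \<in> \<sigma>"; cases "v = b k") (simp_all add: g_def coord)
  qed
  have "subtopology (geometric_realization K) U = top_of_set U"
    unfolding geometric_realization_eq by (simp add: subtopology_subtopology U_def Int_absorb1 Int_assoc[symmetric])
  moreover have "subtopology (Euclidean_space k) W = top_of_set W"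
    unfolding E by (simp add: subtopology_subtopology W_def Int_assoc[symmetric])
  moreover have "U homeomorphic W"
    unfolding homeomorphic_def homeomorphism_def
  proof (intro exI conjI ballI)
    show "f ` U = W" using f_W g_U fg by (metis image_eqI image_subsetI subsetI subset_antisym)
    show "g ` W = U" using f_W g_U gf by (metis image_eqI image_subsetI subsetI subset_antisym)
  qed (fact gf fg cont_f cont_g)+
  moreover have "barycenter \<sigma> \<in> U"
    using barycenter_in_realization[OF K \<sigma>(1) ne] fin ne
    by (auto simp: U_def barycenter_def card_gt_0_iff)
  ultimately show ?thesis
    using that[OF openU _ openW] by (simp add: homeomorphic_space_iff_homeomorphic)
qed

lemma Hausdorff_geometric_realization: "Hausdorff_space (geometric_realization K)"
  unfolding geometric_realization_def
  by (intro Hausdorff_space_subtopology) (simp add: Hausdorff_space_product_topology)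

text \<open>
  The simplices are added one at a time, in order of increasing dimension. Puncturing a simplex
  \<open>\<sigma>\<close> of greatest dimension at its barycenter leaves, up to homotopy, the complex without \<open>\<sigma>\<close>; the
  local contribution at the barycenter is that of a Euclidean space of the dimension of \<open>\<sigma>\<close>.
\<close>
theorem has_euler_characteristic_realization:
  assumes "finite_simplicial_complex K"
  shows "has_euler_characteristic (geometric_realization K) {} (\<Sum>\<tau>\<in>K - {{}}. (-1) ^ (card \<tau> - 1))"
  using assms
proof (induction "card K" arbitrary: K rule: less_induct)
  case less
  have K: "finite K" "{} \<in> K" "\<And>\<sigma>. \<sigma> \<in> K \<Longrightarrow> finite \<sigma>"
    using less.prems by (auto simp: finite_simplicial_complex_def)
  show ?case
  proof (cases "K = {{}}")
    case True
    have "topspace (geometric_realization K) = {}"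
      unfolding topspace_geometric_realization realization_points_def True by auto
    then show ?thesis using has_euler_characteristic_empty True by simp
  next
    case False
    obtain \<sigma> where \<sigma>: "\<sigma> \<in> K" and max: "\<And>\<tau>. \<tau> \<in> K \<Longrightarrow> card \<tau> \<le> card \<sigma>"
      using Max_in[of "card ` K"] Max_ge[of "card ` K"] K(1,2)
      by (metis (no_types, lifting) empty_iff finite_imageI image_iff)
    obtain \<tau> where "\<tau> \<in> K" "\<tau> \<noteq> {}" using False K(2) by blast
    then have "card \<sigma> \<noteq> 0" using max[of \<tau>] K(3)[of \<tau>] by auto
    then obtain k where k: "card \<sigma> = Suc k" using not0_implies_Suc by blast
    then have ne: "\<sigma> \<noteq> {}" by auto
    have maximal: "\<tau> = \<sigma>" if "\<tau> \<in> K" "\<sigma> \<subseteq> \<tau>" for \<tau>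
      using card_seteq[OF K(3)[OF that(1)] that(2) max[OF that(1)]] by simp
    let ?x = "barycenter \<sigma>" and ?L = "{\<tau>\<in>K. \<not> \<sigma> \<subseteq> \<tau>}"
    have L: "?L = K - {\<sigma>}" using maximal \<sigma> by auto
    interpret point_of_realization K ?x
      using less.prems \<sigma> ne by unfold_locales (auto intro: barycenter_in_realization)
    have supp: "carrier_simplex = \<sigma>" using K(3)[OF \<sigma>] by (rule barycenter_support)
    obtain U W where "openin (geometric_realization K) U" "?x \<in> U" "openin (Euclidean_space k) W"
      "subtopology (geometric_realization K) U homeomorphic_space subtopology (Euclidean_space k) W"
      using open_simplex_chart[OF less.prems \<sigma> k maximal] .
    then have local: "has_euler_characteristic (geometric_realization K)
        (topspace (geometric_realization K) - {?x}) ((-1) ^ k)"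
      by (rule has_euler_characteristic_local[OF Hausdorff_geometric_realization])
    have "card ?L < card K"
      unfolding L using K(1) \<sigma> by (rule card_Diff1_less)
    then have "has_euler_characteristic (geometric_realization ?L) {}
        (\<Sum>\<tau>\<in>?L - {{}}. (-1) ^ (card \<tau> - 1))"
      using finite_simplicial_complex_remove_star[OF less.prems ne] by (rule less.hyps)
    from has_euler_characteristic_star[unfolded supp, OF this local]
    have "has_euler_characteristic (geometric_realization K) {}
        ((\<Sum>\<tau>\<in>?L - {{}}. (-1) ^ (card \<tau> - 1)) + (-1) ^ k)" .
    moreover have "(\<Sum>\<tau>\<in>K - {{}}. (-1) ^ (card \<tau> - 1)) =
        (\<Sum>\<tau>\<in>?L - {{}}. (-1) ^ (card \<tau> - 1)) + ((-1) ^ k :: int)"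
    proof -
      have "?L - {{}} = K - {{}} - {\<sigma>}" unfolding L by blast
      then show ?thesis
        using sum.remove[of "K - {{}}" \<sigma> "\<lambda>\<tau>. (-1) ^ (card \<tau> - 1) :: int"] K(1) \<sigma> ne k
        by simp
    qed
    ultimately show ?thesis by simp
  qed
qed

text \<open>
  Removing the barycenter of \<open>\<sigma>\<close> from the realization removes, up to homotopy, the simplices
  containing \<open>\<sigma>\<close>. The change of the Euler characteristic is thus the alternating sum over these
  simplices; on a manifold it is also the local contribution \<open>(-1)\<^sup>d\<close> at a point.
\<close>
theorem star_euler_relation:
  assumes "simplicial_manifold d K" "\<sigma> \<in> K" "\<sigma> \<noteq> {}"
  shows "(\<Sum>\<tau> | \<tau> \<in> K \<and> \<sigma> \<subseteq> \<tau>. (-1) ^ card \<tau>) = ((-1) ^ Suc d :: int)"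
proof -
  have K: "finite_simplicial_complex K" and man: "topological_manifold d (geometric_realization K)"
    using assms(1) by (auto simp: simplicial_manifold_def)
  have fin: "finite K" "finite \<sigma>" using K assms(2) by (auto simp: finite_simplicial_complex_def)
  let ?x = "barycenter \<sigma>" and ?L = "{\<tau>\<in>K. \<not> \<sigma> \<subseteq> \<tau>}" and ?S = "{\<tau>\<in>K. \<sigma> \<subseteq> \<tau>}"
  let ?e = "\<lambda>\<tau> :: 'a set. (-1) ^ (card \<tau> - 1) :: int"
  interpret point_of_realization K ?x
    using K assms(2,3) by unfold_locales (auto intro: barycenter_in_realization)
  have supp: "carrier_simplex = \<sigma>" using fin(2) by (rule barycenter_support)
  have "?x \<in> topspace (geometric_realization K)"
    unfolding topspace_geometric_realization by (rule x)
  then obtain U W where "openin (geometric_realization K) U" "?x \<in> U" "openin (Euclidean_space d) W"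
      "subtopology (geometric_realization K) U homeomorphic_space subtopology (Euclidean_space d) W"
    using man unfolding topological_manifold_def by blast
  then have local: "has_euler_characteristic (geometric_realization K)
      (topspace (geometric_realization K) - {?x}) ((-1) ^ d)"
    by (rule has_euler_characteristic_local[OF Hausdorff_geometric_realization])
  have "has_euler_characteristic (geometric_realization ?L) {} (\<Sum>\<tau>\<in>?L - {{}}. ?e \<tau>)"
    using finite_simplicial_complex_remove_star[OF K assms(3)]
    by (rule has_euler_characteristic_realization)
  from has_euler_characteristic_star[unfolded supp, OF this local]
  have "(\<Sum>\<tau>\<in>K - {{}}. ?e \<tau>) = (\<Sum>\<tau>\<in>?L - {{}}. ?e \<tau>) + (-1) ^ d"
    by (rule has_euler_characteristic_unique[OF has_euler_characteristic_realization[OF K]])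
  moreover have "(\<Sum>\<tau>\<in>K - {{}}. ?e \<tau>) = (\<Sum>\<tau>\<in>?L - {{}}. ?e \<tau>) + (\<Sum>\<tau>\<in>?S. ?e \<tau>)"
    using fin(1) assms(3) by (subst sum.union_disjoint[symmetric]) (auto intro!: sum.cong)
  ultimately have "(\<Sum>\<tau>\<in>?S. ?e \<tau>) = (-1) ^ d" by simp
  moreover have "(\<Sum>\<tau>\<in>?S. (-1) ^ card \<tau>) = - (\<Sum>\<tau>\<in>?S. ?e \<tau>)"
  proof -
    have "(-1) ^ card \<tau> = - ?e \<tau>" if "\<tau> \<in> ?S" for \<tau>
    proof -
      have "card \<tau> \<noteq> 0" using that K assms(3) by (auto simp: finite_simplicial_complex_def)
      then show ?thesis by (cases "card \<tau>") auto
    qed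
    then show ?thesis by (simp add: sum_negf)
  qed
  ultimately show ?thesis by simp
qed

section \<open>Reversing the h-vector\<close>

lemma card_le_dimension:
  assumes "finite_simplicial_complex K" "complex_dim K = int n - 1" "\<sigma> \<in> K"
  shows "card \<sigma> \<le> n"
proof -
  have "simplex_dim \<sigma> \<le> complex_dim K"
    using assms unfolding complex_dim_def finite_simplicial_complex_def by (intro Max_ge) auto
  then show ?thesis using assms(2) by (simp add: simplex_dim_def)
qed

lemma sum_f_vector:
  assumes "finite K" "\<And>\<sigma>. \<sigma> \<in> K \<Longrightarrow> card \<sigma> \<in> J" "finite J"
  shows "(\<Sum>j\<in>J. of_nat (f_vector K (int j - 1)) * g j) = (\<Sum>\<sigma>\<in>K. g (card \<sigma>) :: 'a::comm_semiring_1)"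
proof -
  have "(\<Sum>\<sigma>\<in>K. g (card \<sigma>)) = (\<Sum>j\<in>J. \<Sum>\<sigma> | \<sigma> \<in> K \<and> card \<sigma> = j. g (card \<sigma>))"
    using assms by (intro sum.group[symmetric]) auto
  also have "\<dots> = (\<Sum>j\<in>J. of_nat (f_vector K (int j - 1)) * g j)"
  proof (rule sum.cong[OF refl])
    fix j
    have "{\<sigma> \<in> K. simplex_dim \<sigma> = int j - 1} = {\<sigma> \<in> K. card \<sigma> = j}"
      by (auto simp: simplex_dim_def)
    then show "(\<Sum>\<sigma> | \<sigma> \<in> K \<and> card \<sigma> = j. g (card \<sigma>)) = of_nat (f_vector K (int j - 1)) * g j"
      by (simp add: f_vector_def)
  qed
  finally show ?thesis ..
qed

lemma euler_number_eq_sum_simplices: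
  assumes "finite_simplicial_complex K" "complex_dim K = int n - 1"
  shows "(\<Sum>\<sigma>\<in>K. (-1) ^ card \<sigma>) = 1 - euler_number K"
proof -
  have K: "finite K" using assms by (simp add: finite_simplicial_complex_def)
  have "(\<Sum>\<sigma>\<in>K. (-1) ^ card \<sigma>) = (\<Sum>j<Suc n. int (f_vector K (int j - 1)) * (-1) ^ j)"
    using K card_le_dimension[OF assms] by (subst sum_f_vector) (auto simp: less_Suc_eq_le)
  also have "\<dots> = 1 - (\<Sum>j<n. (-1) ^ j * int (f_vector K (int j)))"
    unfolding sum.lessThan_Suc_shift
    by (simp add: f_vector_minus_one[OF assms(1)] sum_negf mult.commute)
  also have "(\<Sum>j<n. (-1) ^ j * int (f_vector K (int j))) = euler_number K"
    using assms(2) by (simp add: euler_number_def atLeast0LessThan)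
  finally show ?thesis .
qed

lemma h_polynomial_eq_sum_simplices:
  assumes "finite_simplicial_complex K" "complex_dim K = int n - 1"
  shows "h_polynomial K = (\<Sum>\<sigma>\<in>K. [:-1, 1:] ^ (n - card \<sigma>))"
proof -
  have K: "finite K" using assms by (simp add: finite_simplicial_complex_def)
  have "(\<Sum>\<sigma>\<in>K. [:-1, 1:] ^ (n - card \<sigma>)) =
      (\<Sum>j = 0..n. of_nat (f_vector K (int j - 1)) * [:-1, 1 :: int:] ^ (n - j))"
    using K card_le_dimension[OF assms] by (subst sum_f_vector) auto
  then show ?thesis
    using assms(2) by (simp add: h_polynomial_def of_nat_poly)
qed

lemma sum_subsets_power:
  fixes x :: "'a::comm_ring_1"
  assumes "finite \<tau>"
  shows "(\<Sum>\<sigma> | \<sigma> \<subseteq> \<tau>. x ^ (card \<tau> - card \<sigma>)) = (1 + x) ^ card \<tau>"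
proof -
  have "(\<Sum>\<sigma> | \<sigma> \<subseteq> \<tau>. x ^ (card \<tau> - card \<sigma>)) = (\<Sum>\<sigma>\<in>Pow \<tau>. prod (\<lambda>_. 1) \<sigma> * prod (\<lambda>_. x) (\<tau> - \<sigma>))"
    using assms by (intro sum.cong) (auto simp: card_Diff_subset finite_subset)
  also have "\<dots> = (\<Prod>i\<in>\<tau>. 1 + x)"
    using prod_add[OF assms, of "\<lambda>_. 1" "\<lambda>_. x"] by simp
  finally show ?thesis by simp
qed

text \<open>
  The polynomial \<open>(1-t)\<^bsup>n-k\<^esup> t\<^bsup>k\<^esup>\<close> arises from \<open>(t-1)\<^bsup>n-k\<^esup>\<close> by reversing the order of the coefficients
  in degrees \<open>0\<close> to \<open>n\<close>.
\<close>
lemma coeff_linear_power_reflect: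
  assumes "k \<le> n"
  shows "Polynomial.coeff ([:1, -1:] ^ (n - k) * [:0, 1:] ^ k) i =
    (if i \<le> n then Polynomial.coeff ([:-1, 1 :: int:] ^ (n - k)) (n - i) else 0)"
proof -
  have "Polynomial.coeff ([:1, -1:] ^ (n - k) * [:0, 1:] ^ k) i =
      (if i < k then 0 else Polynomial.coeff ([:1, -1 :: int:] ^ (n - k)) (i - k))"
    using coeff_monom_mult[of 1 k "[:1, -1 :: int:] ^ (n - k)" i]
    by (simp add: monom_altdef mult.commute not_less)
  also have "\<dots> = (if i \<le> n then Polynomial.coeff ([:-1, 1:] ^ (n - k)) (n - i) else 0)"
  proof (cases "k \<le> i \<and> i \<le> n")
    case True
    then have "i - k \<le> n - k" "n - i \<le> n - k" "n - k - (i - k) = n - i" "n - k - (n - i) = i - k"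
      using assms by auto
    then show ?thesis
      using True binomial_symmetric[of "i - k" "n - k"] by (simp add: coeff_linear_poly_power)
  next
    case False
    have "Polynomial.coeff ([:1, -1 :: int:] ^ (n - k)) (i - k) = 0" if "i > n"
      using that assms by (intro coeff_eq_0) (simp add: degree_linear_power_neg)
    moreover have "Polynomial.coeff ([:-1, 1 :: int:] ^ (n - k)) (n - i) = 0" if "i < k"
      using that assms by (intro coeff_eq_0) (simp add: degree_linear_power)
    ultimately show ?thesis using False assms by auto
  qed
  finally show ?thesis .
qed

text \<open>
  In the sum over \<open>\<tau>\<close> write \<open>(1+s)\<^bsup>card \<tau>\<^esup>\<close> as a sum over the faces \<open>\<sigma>\<close> of \<open>\<tau>\<close> and exchange the order of
  summation. The weight collected by \<open>s\<^bsup>n - card \<sigma>\<^esup>\<close> is \<open>(-1)\<^sup>n\<close> times the alternating sum over the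
  simplices that contain \<open>\<sigma>\<close>, which makes \<open>1\<close> for nonempty \<open>\<sigma>\<close>. The empty simplex carries the Euler
  number and accounts for the correction term.
\<close>
lemma sum_simplices_reflection:
  fixes K :: "'v set set" and s :: "'a::comm_ring_1"
  assumes K: "finite_simplicial_complex K" and dim: "complex_dim K = int n - 1" and n: "n \<ge> 1"
    and star: "\<And>\<sigma>. \<sigma> \<in> K \<Longrightarrow> \<sigma> \<noteq> {} \<Longrightarrow> (\<Sum>\<tau> | \<tau> \<in> K \<and> \<sigma> \<subseteq> \<tau>. (-1) ^ card \<tau>) = ((-1) ^ n :: int)"
  shows "(\<Sum>\<sigma>\<in>K. s ^ (n - card \<sigma>)) =
      (\<Sum>\<tau>\<in>K. (-s) ^ (n - card \<tau>) * (1 + s) ^ card \<tau>)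
      + of_int (euler_number K - (1 + (-1) ^ (n - 1))) * (-s) ^ n"
proof -
  have fin: "finite K" "\<And>\<sigma>. \<sigma> \<in> K \<Longrightarrow> finite \<sigma>" and sub: "\<And>\<sigma> \<tau>. \<sigma> \<subseteq> \<tau> \<Longrightarrow> \<tau> \<in> K \<Longrightarrow> \<sigma> \<in> K" and empty: "{} \<in> K"
    using K unfolding finite_simplicial_complex_def by blast+
  have card_le: "card \<sigma> \<le> n" if "\<sigma> \<in> K" for \<sigma> using card_le_dimension[OF K dim that] .
  define w :: "'v set \<Rightarrow> int" where "w = (\<lambda>\<sigma>. (-1) ^ n * (\<Sum>\<tau> | \<tau> \<in> K \<and> \<sigma> \<subseteq> \<tau>. (-1) ^ card \<tau>))"
  have expand: "(-s) ^ (n - card \<tau>) * (1 + s) ^ card \<tau> =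
      (\<Sum>\<sigma> | \<sigma> \<subseteq> \<tau>. (-1) ^ n * (-1) ^ card \<tau> * s ^ (n - card \<sigma>))" if \<tau>: "\<tau> \<in> K" for \<tau>
  proof -
    have sign: "(-1) ^ (n - card \<tau>) = (-1) ^ n * ((-1) ^ card \<tau> :: 'a)"
      using card_le[OF \<tau>] by (simp add: power_add[symmetric] minus_one_power_iff)
    have "(-s) ^ (n - card \<tau>) * (1 + s) ^ card \<tau> =
        (\<Sum>\<sigma> | \<sigma> \<subseteq> \<tau>. (-s) ^ (n - card \<tau>) * s ^ (card \<tau> - card \<sigma>))"
      by (simp add: sum_subsets_power[OF fin(2)[OF \<tau>], symmetric] sum_distrib_left)
    also have "\<dots> = (\<Sum>\<sigma> | \<sigma> \<subseteq> \<tau>. (-1) ^ n * (-1) ^ card \<tau> * s ^ (n - card \<sigma>))"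
    proof (rule sum.cong[OF refl])
      fix \<sigma> assume "\<sigma> \<in> {\<sigma>. \<sigma> \<subseteq> \<tau>}"
      then have "card \<sigma> \<le> card \<tau>" using fin(2)[OF \<tau>] by (auto intro: card_mono)
      then have "n - card \<sigma> = (n - card \<tau>) + (card \<tau> - card \<sigma>)" using card_le[OF \<tau>] by simp
      then show "(-s) ^ (n - card \<tau>) * s ^ (card \<tau> - card \<sigma>) =
          (-1) ^ n * (-1) ^ card \<tau> * s ^ (n - card \<sigma>)"
        using power_minus[of s "n - card \<tau>"] by (simp add: power_add sign mult.assoc)
    qed
    finally show ?thesis .
  qed
  have "(\<Sum>\<tau>\<in>K. (-s) ^ (n - card \<tau>) * (1 + s) ^ card \<tau>) =
      (\<Sum>\<tau>\<in>K. \<Sum>\<sigma> | \<sigma> \<in> K \<and> \<sigma> \<subseteq> \<tau>. (-1) ^ n * (-1) ^ card \<tau> * s ^ (n - card \<sigma>))"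
    using sub by (intro sum.cong refl) (auto simp: expand intro!: sum.cong)
  also have "\<dots> = (\<Sum>\<sigma>\<in>K. \<Sum>\<tau> | \<tau> \<in> K \<and> \<sigma> \<subseteq> \<tau>. (-1) ^ n * (-1) ^ card \<tau> * s ^ (n - card \<sigma>))"
    using fin(1) by (rule sum.swap_restrict[OF _ fin(1)])
  also have "\<dots> = (\<Sum>\<sigma>\<in>K. of_int (w \<sigma>) * s ^ (n - card \<sigma>))"
    by (simp add: w_def sum_distrib_left sum_distrib_right)
  also have "\<dots> = (\<Sum>\<sigma>\<in>K. s ^ (n - card \<sigma>) + (if \<sigma> = {} then (of_int (w {}) - 1) * s ^ n else 0))"
  proof (rule sum.cong[OF refl])
    fix \<sigma> assume \<sigma>: "\<sigma> \<in> K"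
    have "w \<sigma> = 1" if "\<sigma> \<noteq> {}"
      using star[OF \<sigma> that] by (simp add: w_def flip: power_mult_distrib)
    then show "of_int (w \<sigma>) * s ^ (n - card \<sigma>) =
        s ^ (n - card \<sigma>) + (if \<sigma> = {} then (of_int (w {}) - 1) * s ^ n else 0)"
      by (auto simp: algebra_simps)
  qed
  also have "\<dots> = (\<Sum>\<sigma>\<in>K. s ^ (n - card \<sigma>)) + (of_int (w {}) - 1) * s ^ n"
    using fin(1) empty by (simp add: sum.distrib)
  also have "w {} = (-1) ^ n * (1 - euler_number K)"
    by (simp add: w_def euler_number_eq_sum_simplices[OF K dim])
  also have "(of_int ((-1) ^ n * (1 - euler_number K)) - 1) * s ^ n
      = - (of_int (euler_number K - (1 + (-1) ^ (n - 1))) * (-s) ^ n)"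
  proof -
    have "(-1) ^ (n - 1) = - ((-1) ^ n :: 'a)" using n by (cases n) auto
    then show ?thesis
      by (cases "even n") (simp_all add: algebra_simps)
  qed
  finally show ?thesis by simp
qed

text \<open>
  With \<open>s = t - 1\<close> the two sums over simplices in the preceding identity are the polynomials with
  coefficients \<open>h\<^bsub>n-i\<^esub>\<close> and \<open>h\<^sub>i\<close> at \<open>t\<^sup>i\<close>.
\<close>
theorem h_vector_reflection:
  assumes K: "finite_simplicial_complex K" and dim: "complex_dim K = int n - 1" and n: "n \<ge> 1"
    and star: "\<And>\<sigma>. \<sigma> \<in> K \<Longrightarrow> \<sigma> \<noteq> {} \<Longrightarrow> (\<Sum>\<tau> | \<tau> \<in> K \<and> \<sigma> \<subseteq> \<tau>. (-1) ^ card \<tau>) = ((-1) ^ n :: int)"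
    and i: "i \<le> n"
  shows "h_vector K (n - i) - h_vector K i =
    (-1) ^ i * (euler_number K - (1 + (-1) ^ (n - 1))) * int (n choose i)"
proof -
  let ?s = "[:-1, 1:] :: int poly" and ?c = "euler_number K - (1 + (-1) ^ (n - 1))"
  note H = h_polynomial_eq_sum_simplices[OF K dim]
  have s: "- ?s = [:1, -1:]" "1 + ?s = [:0, 1:]" by (simp_all add: one_pCons)
  have "h_polynomial K = (\<Sum>\<tau>\<in>K. [:1, -1:] ^ (n - card \<tau>) * [:0, 1:] ^ card \<tau>)
      + of_int ?c * [:1, -1:] ^ n"
    using sum_simplices_reflection[OF K dim n star, of ?s] unfolding H s .
  then have "Polynomial.coeff (h_polynomial K) i =
      (\<Sum>\<tau>\<in>K. Polynomial.coeff ([:1, -1:] ^ (n - card \<tau>) * [:0, 1:] ^ card \<tau>) i)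
      + ?c * Polynomial.coeff ([:1, -1:] ^ n) i"
    by (simp add: coeff_sum of_int_poly)
  also have "(\<Sum>\<tau>\<in>K. Polynomial.coeff ([:1, -1:] ^ (n - card \<tau>) * [:0, 1:] ^ card \<tau>) i)
      = Polynomial.coeff (h_polynomial K) (n - i)"
    unfolding H coeff_sum using i card_le_dimension[OF K dim]
    by (intro sum.cong refl) (simp add: coeff_linear_power_reflect)
  finally have "Polynomial.coeff (h_polynomial K) i - Polynomial.coeff (h_polynomial K) (n - i)
      = ?c * Polynomial.coeff ([:1, -1:] ^ n) i" by simp
  then show ?thesis
    using i dim by (simp add: h_vector_def coeff_linear_poly_power)
qed

theorem corollary5p4:
  fixes K :: "'v set set" and n i :: nat
  assumes "n \<ge> 1"
    and "simplicial_manifold (n - 1) K"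
    and "i \<le> n"
  shows "h_vector K (n - i) - h_vector K i =
         (-1) ^ i * (euler_number K - (1 + (-1) ^ (n - 1))) * int (n choose i)"
proof (rule h_vector_reflection)
  show "finite_simplicial_complex K" "complex_dim K = int n - 1"
    using assms(1,2) by (auto simp: simplicial_manifold_def)
  show "(\<Sum>\<tau> | \<tau> \<in> K \<and> \<sigma> \<subseteq> \<tau>. (-1) ^ card \<tau>) = ((-1) ^ n :: int)" if "\<sigma> \<in> K" "\<sigma> \<noteq> {}" for \<sigma>
    using star_euler_relation[OF assms(2) that] assms(1) by simp
qed (fact assms)+

end
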